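(* Fix a dataset $\mathcal{D}=\{v_1,\dots,v_n\}\subset\mathbb{R}^d$ of unit vectors, a unit query $q\in\mathbb{R}^d$, an angle range $\mathcal{A}\subseteq[0,\pi]$, a hash length $t$ and a set of Hamming distances $\mathcal{I}\subseteq\{0,1,\dots,t\}$. For any $\epsilon,\delta\in(0,1)$, with probability at least $1-\delta$ the LSH Count estimator returns a $(1\pm\epsilon)$-approximation to $|\mathcal{A}_q|$, i.e. a value in $[(1-\epsilon)|\mathcal{A}_q|,(1+\epsilon)|\mathcal{A}_q|]$, using $$O\left(\frac{1}{\epsilon^2 \min_{x \in \mathcal{A}_q} p(x)} \log\frac{1}{\delta}\right)$$ hash tables and $$O\left(\frac{\mathbb{E}(C_q(\mathcal{I}))}{\epsilon^2|\mathcal{A}_q| \cdot \min_{x \in \mathcal{A}_q}p(x)}\log\frac{1}{\delta}\right)$$ samples.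
   Context: Notation. For unit vectors $u,v$ let $\theta_{uv}=\arccos(u\cdot v)$. Let $\mathcal{A}_q=\{v\in\mathcal{D}:\theta_{qv}\in\mathcal{A}\}$. Random hyperplane hashing. For $r\in\mathbb{R}^d$ put $h_r(v)=0$ if $r\cdot v\le 0$ and $h_r(v)=1$ otherwise. A hash table $k$ uses $g_k(v)=(h_{r_{k,1}}(v),\dots,h_{r_{k,t}}(v))\in\{0,1\}^t$, where all vectors $r_{k,j}$ (over all tables $k=1,\dots,K$ and bits $j=1,\dots,t$) are independent standard Gaussian vectors in $\mathbb{R}^d$. Each $v\in\mathcal{D}$ is stored in bucket $g_k(v)$ of table $k$. Key quantities. $d^k_{qx}$ is the Hamming distance between $g_k(q)$ and $g_k(x)$. Let $p(x)=\mathbb{P}(d_{qx}\in\mathcal{I}\mid\theta_{qx})=\sum_{i\in\mathcal{I}}\binom{t}{i}\left(1-\frac{\theta_{qx}}{\pi}\right)^{t-i}\left(\frac{\theta_{qx}}{\pi}\right)^i$. This is the probability, over the random hash functions of one table, that $x$ lands in a bucket at Hamming distance in $\mathcal{I}$ from $q$'s bucket. Let $\mathcal{B}^k_q(\mathcal{I})$ be the set of elements of $\mathcal{D}$ stored in table $k$ in buckets at Hamming distance in $\mathcal{I}$ from $g_k(q)$, and let $C^k_q(\mathcal{I})=|\mathcal{B}^k_q(\mathcal{I})|$. $\mathbb{E}(C_q(\mathcal{I}))$ denotes the expectation, over the random hash functions, of this count for a single table. LSH Count estimator. Build $K$ tables. Draw a sample $x$ uniformly from the multiset union of $\mathcal{B}^1_q(\mathcal{I}),\dots,\mathcal{B}^K_q(\mathcal{I})$,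 so that $x$ is drawn with probability $\sum_k \mathbf{1}(x\in\mathcal{B}^k_q(\mathcal{I}))/\sum_k C^k_q(\mathcal{I})$. Set $$Z=\frac{\sum_{k=1}^K C^k_q(\mathcal{I})}{K\,p(x)}\ \text{ if } \theta_{qx}\in\mathcal{A},\qquad Z=0 \text{ otherwise}.$$ With $S$ independent samples $Z_1,\dots,Z_S$ the estimate is $\frac1S\sum_{i=1}^S Z_i$. To reach failure probability $\delta$, independent copies of this estimator are combined by a median of means. The table and sample counts in the claim are totals over all copies.
   Formalization: log(1/δ) is replaced by max(1, ln(1/δ)), since the literal bounds fall below one table as δ→1; p(x)>0 is assumed for x in A_q, as otherwise the bounds divide by zero; for empty A_q, where the minimum is undefined, only the approximation guarantee is claimed. *)

theory Defs
  imports "HOL-Probability.Probability"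
begin

text \<open>
  The dimension is an ordinary natural number and not a type, so that the hidden constants of the
  main claim can be quantified before it. A vector of \<open>\<real>\<^sup>d\<close> is an element of
  \<open>{..<d} \<rightarrow>\<^sub>E UNIV\<close>; extensionality makes equality of functions coincide with equality of vectors.
\<close>

definition unit_vectors :: "nat \<Rightarrow> (nat \<Rightarrow> real) set" where
  "unit_vectors d = {v \<in> {..<d} \<rightarrow>\<^sub>E UNIV. L2_set v {..<d} = 1}"

definition dotp :: "nat \<Rightarrow> (nat \<Rightarrow> real) \<Rightarrow> (nat \<Rightarrow> real) \<Rightarrow> real" where
  "dotp d u v = (\<Sum>i<d. u i * v i)"

definition angle :: "nat \<Rightarrow> (nat \<Rightarrow> real) \<Rightarrow> (nat \<Rightarrow> real) \<Rightarrow> real" where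
  "angle d u v = arccos (dotp d u v)"

definition angle_set ::
  "nat \<Rightarrow> (nat \<Rightarrow> real) set \<Rightarrow> (nat \<Rightarrow> real) \<Rightarrow> real set \<Rightarrow> (nat \<Rightarrow> real) set" where
  "angle_set d D q A = {v \<in> D. angle d q v \<in> A}"

definition hash_bit :: "nat \<Rightarrow> (nat \<Rightarrow> real) \<Rightarrow> (nat \<Rightarrow> real) \<Rightarrow> nat" where
  "hash_bit d r v = (if dotp d r v \<le> 0 then 0 else 1)"

text \<open>
  The randomness of one table is a family \<open>r\<close> of \<open>t\<close> vectors, the bits of the bucket label of \<open>v\<close>
  being \<open>hash_bit d (r j) v\<close> for \<open>j < t\<close>.
\<close>

definition hamming ::
  "nat \<Rightarrow> nat \<Rightarrow> (nat \<Rightarrow> nat \<Rightarrow> real) \<Rightarrow> (nat \<Rightarrow> real) \<Rightarrow> (nat \<Rightarrow> real) \<Rightarrow> nat" where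
  "hamming d t r u v = card {j \<in> {..<t}. hash_bit d (r j) u \<noteq> hash_bit d (r j) v}"

definition bucket ::
  "nat \<Rightarrow> (nat \<Rightarrow> real) set \<Rightarrow> (nat \<Rightarrow> real) \<Rightarrow> nat \<Rightarrow> nat set \<Rightarrow> (nat \<Rightarrow> nat \<Rightarrow> real) \<Rightarrow> (nat \<Rightarrow> real) set" where
  "bucket d D q t I r = {x \<in> D. hamming d t r q x \<in> I}"

definition gaussian_vector :: "nat \<Rightarrow> (nat \<Rightarrow> real) measure" where
  "gaussian_vector d = Pi\<^sub>M {..<d} (\<lambda>_. std_normal_distribution)"

definition table_law :: "nat \<Rightarrow> nat \<Rightarrow> (nat \<Rightarrow> nat \<Rightarrow> real) measure" where
  "table_law d t = Pi\<^sub>M {..<t} (\<lambda>_. gaussian_vector d)"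

definition tables_law :: "nat \<Rightarrow> nat \<Rightarrow> nat \<Rightarrow> (nat \<Rightarrow> nat \<Rightarrow> nat \<Rightarrow> real) measure" where
  "tables_law d t K = Pi\<^sub>M {..<K} (\<lambda>_. table_law d t)"

definition expected_count ::
  "nat \<Rightarrow> (nat \<Rightarrow> real) set \<Rightarrow> (nat \<Rightarrow> real) \<Rightarrow> nat \<Rightarrow> nat set \<Rightarrow> real" where
  "expected_count d D q t I = (\<integral>r. real (card (bucket d D q t I r)) \<partial>table_law d t)"

definition near_prob :: "nat \<Rightarrow> nat \<Rightarrow> nat set \<Rightarrow> (nat \<Rightarrow> real) \<Rightarrow> (nat \<Rightarrow> real) \<Rightarrow> real" where
  "near_prob d t I q x =
     (\<Sum>i\<in>I. real (t choose i) * (1 - angle d q x / pi) ^ (t - i) * (angle d q x / pi) ^ i)"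

definition stored ::
  "nat \<Rightarrow> (nat \<Rightarrow> real) set \<Rightarrow> (nat \<Rightarrow> real) \<Rightarrow> nat \<Rightarrow> nat set \<Rightarrow> nat \<Rightarrow> (nat \<Rightarrow> nat \<Rightarrow> nat \<Rightarrow> real)
    \<Rightarrow> (nat \<Rightarrow> real) multiset" where
  "stored d D q t I K R = (\<Sum>k<K. mset_set (bucket d D q t I (R k)))"

text \<open>
  If all the buckets concerned are empty, there is nothing to sample from, and
  \<open>pmf_of_multiset {#}\<close> is an unspecified distribution. This is harmless:
  the numerator is then 0, so \<open>Z_value\<close> is 0 whatever \<open>x\<close> is.
\<close>

definition Z_value ::
  "nat \<Rightarrow> (nat \<Rightarrow> real) set \<Rightarrow> (nat \<Rightarrow> real) \<Rightarrow> real set \<Rightarrow> nat \<Rightarrow> nat set \<Rightarrow> nat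
    \<Rightarrow> (nat \<Rightarrow> nat \<Rightarrow> nat \<Rightarrow> real) \<Rightarrow> (nat \<Rightarrow> real) \<Rightarrow> real" where
  "Z_value d D q A t I K R x =
     (if angle d q x \<in> A
      then (\<Sum>k<K. real (card (bucket d D q t I (R k)))) / (real K * near_prob d t I q x)
      else 0)"

text \<open>
  The law of the mean of \<open>S\<close> values of \<open>Z\<close>: first the \<open>K\<close> tables are drawn, and then, given the
  tables, \<open>S\<close> independent samples from them.
\<close>

definition mean_law ::
  "nat \<Rightarrow> (nat \<Rightarrow> real) set \<Rightarrow> (nat \<Rightarrow> real) \<Rightarrow> real set \<Rightarrow> nat \<Rightarrow> nat set \<Rightarrow> nat \<Rightarrow> nat \<Rightarrow> real measure" where
  "mean_law d D q A t I K S =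
     tables_law d t K \<bind> (\<lambda>R.
       distr (measure_pmf (replicate_pmf S (pmf_of_multiset (stored d D q t I K R)))) borel
         (\<lambda>xs. (\<Sum>x\<leftarrow>xs. Z_value d D q A t I K R x) / real S))"

definition median :: "real list \<Rightarrow> real" where
  "median xs = (sort xs ! ((length xs - 1) div 2) + sort xs ! (length xs div 2)) / 2"

text \<open>
  The law of the median over \<open>m\<close> independent copies, each with its own \<open>K\<close> tables and \<open>S\<close> samples.
\<close>

definition lsh_count_law ::
  "nat \<Rightarrow> (nat \<Rightarrow> real) set \<Rightarrow> (nat \<Rightarrow> real) \<Rightarrow> real set \<Rightarrow> nat \<Rightarrow> nat set \<Rightarrow> nat \<Rightarrow> nat \<Rightarrow> nat
    \<Rightarrow> real measure" where
  "lsh_count_law d D q A t I m K S =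
     distr (Pi\<^sub>M {..<m} (\<lambda>_. mean_law d D q A t I K S)) borel (\<lambda>Y. median (map Y [0..<m]))"

end

theory Submission
  imports Defs
begin

text \<open>
  A random hyperplane separates two unit vectors with probability \<open>\<theta> / \<pi>\<close>, so \<open>p(x)\<close> is the
  probability that one table puts \<open>x\<close> near \<open>q\<close>. Hence, given the tables, a sample \<open>Z\<close> has mean
  \<open>W = 1/K * (\<Sum>k. \<Sum>x\<in>\<A>\<^sub>q. 1[x \<in> B\<^sup>k] / p(x))\<close>, which is unbiased and has variance at most
  \<open>\<bar>\<A>\<^sub>q\<bar>\<^sup>2 / (K p)\<close> with \<open>p = min p(x)\<close>, while \<open>\<E>(Z\<^sup>2) \<le> \<E>(C) \<bar>\<A>\<^sub>q\<bar> / p * (1 + 1 / (K p))\<close>. The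
  number of tables controls the first term and the number of samples the second, so that
  Chebyshev's inequality bounds the failure probability of one copy by \<open>1/4\<close>; the median of
  \<open>O(log (1 / \<delta>))\<close> copies then fails with probability at most \<open>\<delta>\<close> by Hoeffding's inequality.
\<close>

section \<open>Projections of a Gaussian vector\<close>

text \<open>Two dependences shape the argument. The samples of one copy share their tables, so they
  are independent only given the tables: the mean square error is bounded conditionally, as
  (conditional second moment) / S + (conditional mean - n)^2 with n the number of points sought, and
  only then averaged over the tables. Within one table the points are correlated too, through the
  shared hyperplanes; no joint law of several points is computed, because in every product of two
  quantities of the same table one factor is replaced by its maximum. The only geometric input is
  thus the joint law of two projections of a Gaussian vector. It is found by induction on the
  dimension with plane rotations, so that rotation invariance is needed in the plane alone. The
  failure budget 1/4 of one copy is split evenly between tables and samples. A failing median needs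
  half of the copies to fail, which leaves a gap of m/4 above the mean for Hoeffding's
  inequality.\<close>

lemma prob_space_std_normal: "prob_space std_normal_distribution"
  by (rule prob_space_normal_density) simp

lemma sigma_finite_std_normal: "sigma_finite_measure std_normal_distribution"
  using prob_space_std_normal
  by (simp add: prob_space_def finite_measure_def)

text \<open>For fixed y a shear is a translation in x, so swapping the integrals reduces the claim
  to translation invariance on the line.\<close>

lemma lborel_shear_fst:
  assumes [measurable]: "case_prod g \<in> borel_measurable (borel \<Otimes>\<^sub>M borel)"
  shows "(\<integral>\<^sup>+x. \<integral>\<^sup>+y. g (x + a * y) y \<partial>lborel \<partial>lborel) = (\<integral>\<^sup>+x. \<integral>\<^sup>+y. g x y \<partial>lborel \<partial>(lborel :: real measure))"
proof -
  have "(\<integral>\<^sup>+x. \<integral>\<^sup>+y. g (x + a * y) y \<partial>lborel \<partial>lborel) = (\<integral>\<^sup>+y. \<integral>\<^sup>+x. g (x + a * y) y \<partial>lborel \<partial>lborel)"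
    by (rule lborel_pair.Fubini') measurable
  also have "\<dots> = (\<integral>\<^sup>+y. \<integral>\<^sup>+x. g x y \<partial>lborel \<partial>lborel)"
    by (rule nn_integral_cong, subst (2) nn_integral_real_affine[where c = 1 and t = "a * y" for y])
       (auto simp: add.commute)
  also have "\<dots> = (\<integral>\<^sup>+x. \<integral>\<^sup>+y. g x y \<partial>lborel \<partial>lborel)"
    by (rule lborel_pair.Fubini') measurable
  finally show ?thesis .
qed

lemma lborel_shear_snd:
  assumes [measurable]: "case_prod g \<in> borel_measurable (borel \<Otimes>\<^sub>M borel)"
  shows "(\<integral>\<^sup>+x. \<integral>\<^sup>+y. g x (y + b * x) \<partial>lborel \<partial>lborel) = (\<integral>\<^sup>+x. \<integral>\<^sup>+y. g x y \<partial>lborel \<partial>(lborel :: real measure))"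
    by (rule nn_integral_cong, subst (2) nn_integral_real_affine[where c = 1 and t = "b * x" for x])
       (auto simp: add.commute)

lemma nn_integral_lborel_uminus:
  assumes [measurable]: "h \<in> borel_measurable borel"
  shows "(\<integral>\<^sup>+x. h (- x) \<partial>lborel) = (\<integral>\<^sup>+x. h x \<partial>(lborel :: real measure))"
  by (subst (2) nn_integral_real_affine[where c = "-1" and t = 0]) auto

text \<open>Away from \<open>c = -1\<close>, a rotation of the plane is a product of three shears.\<close>

lemma lborel_rotation:
  assumes [measurable]: "case_prod g \<in> borel_measurable (borel \<Otimes>\<^sub>M borel)"
    and cs: "c\<^sup>2 + s\<^sup>2 = 1"
  shows "(\<integral>\<^sup>+x. \<integral>\<^sup>+y. g (c * x + s * y) (- s * x + c * y) \<partial>lborel \<partial>lborel)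
    = (\<integral>\<^sup>+x. \<integral>\<^sup>+y. g x y \<partial>lborel \<partial>(lborel :: real measure))"
proof (cases "c = -1")
  \<comment> \<open>The half turn, where the coefficient \<open>a\<close> below would divide by
    zero, is a reflection in each variable.\<close>
  case True
  with cs have "s = 0" by simp
  have "(\<integral>\<^sup>+x. \<integral>\<^sup>+y. g (- x) (- y) \<partial>lborel \<partial>lborel) = (\<integral>\<^sup>+x. \<integral>\<^sup>+y. g (- x) y \<partial>lborel \<partial>lborel)"
    by (intro nn_integral_cong nn_integral_lborel_uminus) simp
  also have "\<dots> = (\<integral>\<^sup>+x. \<integral>\<^sup>+y. g x y \<partial>lborel \<partial>lborel)"
    by (intro nn_integral_lborel_uminus[of "\<lambda>x. \<integral>\<^sup>+y. g x y \<partial>lborel"]) simp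
  finally show ?thesis using True \<open>s = 0\<close> by simp
next
  case False
  \<comment> \<open>The tangent of half the rotation angle. Shears with coefficients
    \<open>a\<close>, \<open>- s\<close>, \<open>a\<close> compose to the rotation because of the
    identities \<open>as\<close> and \<open>a2\<close>.\<close>
  define a where "a = s / (1 + c)"
  have c1: "1 + c \<noteq> 0" using False by simp
  have as: "1 - a * s = c"
  proof -
    have "s * s = (1 + c) * (1 - c)" using cs by (simp add: algebra_simps power2_eq_square)
    then have "a * s = 1 - c" using c1 by (simp add: a_def)
    then show ?thesis by simp
  qed
  have a2: "a * (1 + c) = s" using c1 by (simp add: a_def)
  have "(\<integral>\<^sup>+x. \<integral>\<^sup>+y. g x y \<partial>lborel \<partial>lborel) = (\<integral>\<^sup>+x. \<integral>\<^sup>+y. g (x + a * y) y \<partial>lborel \<partial>lborel)"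
    by (simp add: lborel_shear_fst)
  also have "\<dots> = (\<integral>\<^sup>+x. \<integral>\<^sup>+y. g (x + a * (y + (- s) * x)) (y + (- s) * x) \<partial>lborel \<partial>lborel)"
    by (rule lborel_shear_snd[symmetric]) measurable
  also have "\<dots> = (\<integral>\<^sup>+x. \<integral>\<^sup>+y. g ((x + a * y) + a * (y + (- s) * (x + a * y))) (y + (- s) * (x + a * y)) \<partial>lborel \<partial>lborel)"
    by (rule lborel_shear_fst[symmetric]) measurable
  also have "\<dots> = (\<integral>\<^sup>+x. \<integral>\<^sup>+y. g (c * x + s * y) (- s * x + c * y) \<partial>lborel \<partial>lborel)"
  proof -
    have 1: "(x + a * y) + a * (- s * x + c * y) = c * x + s * y" for x y
    proof -
      have "(x + a * y) + a * (- s * x + c * y) = (1 - a * s) * x + a * (1 + c) * y"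
        by (simp add: algebra_simps)
      then show ?thesis by (simp add: as a2)
    qed
    have 2: "y + (- s) * (x + a * y) = - s * x + c * y" for x y
    proof -
      have "y + (- s) * (x + a * y) = - s * x + (1 - a * s) * y" by (simp add: algebra_simps)
      then show ?thesis by (simp add: as)
    qed
    show ?thesis unfolding 2 unfolding 1 by (rule refl)
  qed
  finally show ?thesis ..
qed

text \<open>The joint density sees only the squared norm, the source of rotation invariance; over
  \<open>lborel\<close> substitutions become available.\<close>

lemma nn_integral_std_normal_pair:
  assumes [measurable]: "case_prod g \<in> borel_measurable (borel \<Otimes>\<^sub>M borel)"
  shows "(\<integral>\<^sup>+x. \<integral>\<^sup>+y. g x y \<partial>std_normal_distribution \<partial>std_normal_distribution)
    = (\<integral>\<^sup>+x. \<integral>\<^sup>+y. ennreal (exp (- (x\<^sup>2 + y\<^sup>2) / 2) / (2 * pi)) * g x y \<partial>lborel \<partial>lborel)"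
proof -
  interpret N: sigma_finite_measure std_normal_distribution by (rule sigma_finite_std_normal)
  have "(\<integral>\<^sup>+x. \<integral>\<^sup>+y. g x y \<partial>std_normal_distribution \<partial>std_normal_distribution)
    = (\<integral>\<^sup>+x. ennreal (std_normal_density x) * (\<integral>\<^sup>+y. g x y \<partial>std_normal_distribution) \<partial>lborel)"
    by (subst nn_integral_density) auto
  also have "\<dots> = (\<integral>\<^sup>+x. \<integral>\<^sup>+y. ennreal (std_normal_density x) * (ennreal (std_normal_density y) * g x y) \<partial>lborel \<partial>lborel)"
    by (rule nn_integral_cong, subst nn_integral_density; (subst nn_integral_cmult)?) measurable
  also have "\<dots> = (\<integral>\<^sup>+x. \<integral>\<^sup>+y. ennreal (exp (- (x\<^sup>2 + y\<^sup>2) / 2) / (2 * pi)) * g x y \<partial>lborel \<partial>lborel)"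
  proof -
    have "std_normal_density x * std_normal_density y = exp (- (x\<^sup>2 + y\<^sup>2) / 2) / (2 * pi)" for x y
    proof -
      have "std_normal_density x * std_normal_density y
        = (exp (- x\<^sup>2 / 2) * exp (- y\<^sup>2 / 2)) / (sqrt (2 * pi) * sqrt (2 * pi))"
        by (simp add: std_normal_density_def)
      also have "exp (- x\<^sup>2 / 2) * exp (- y\<^sup>2 / 2) = exp (- (x\<^sup>2 + y\<^sup>2) / 2)"
        unfolding exp_add[symmetric] by (rule arg_cong[where f = exp]) (simp add: field_simps)
      also have "sqrt (2 * pi) * sqrt (2 * pi) = 2 * pi" by (rule real_sqrt_mult_self[THEN trans]) simp
      finally show ?thesis .
    qed
    moreover have "ennreal (std_normal_density x) * (ennreal (std_normal_density y) * g x y)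
      = ennreal (std_normal_density x * std_normal_density y) * g x y" for x y
      by (simp add: ennreal_mult mult.assoc)
    ultimately show ?thesis by simp
  qed
  finally show ?thesis .
qed

text \<open>A rotation preserves both Lebesgue measure and the squared norm in the density.\<close>

lemma std_normal_rotation:
  assumes [measurable]: "case_prod g \<in> borel_measurable (borel \<Otimes>\<^sub>M borel)"
    and cs: "c\<^sup>2 + s\<^sup>2 = 1"
  shows "(\<integral>\<^sup>+x. \<integral>\<^sup>+y. g (c * x + s * y) (- s * x + c * y) \<partial>std_normal_distribution \<partial>std_normal_distribution)
    = (\<integral>\<^sup>+x. \<integral>\<^sup>+y. g x y \<partial>std_normal_distribution \<partial>std_normal_distribution)"
proof -
  have norm: "(c * x + s * y)\<^sup>2 + (- s * x + c * y)\<^sup>2 = x\<^sup>2 + y\<^sup>2" for x y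
  proof -
    have "(c * x + s * y)\<^sup>2 + (- s * x + c * y)\<^sup>2 = (c\<^sup>2 + s\<^sup>2) * (x\<^sup>2 + y\<^sup>2)"
      by (simp add: algebra_simps power2_eq_square)
    then show ?thesis by (simp add: cs)
  qed
  show ?thesis
    using lborel_rotation[of "\<lambda>x y. ennreal (exp (- (x\<^sup>2 + y\<^sup>2) / 2) / (2 * pi)) * g x y" c s] cs
    unfolding norm by (simp add: nn_integral_std_normal_pair)
qed

text \<open>The origin is included, with an arbitrary direction: in the induction over the dimension
  the initial coordinates of a vector may all be zero.\<close>

lemma polar_coordinates:
  fixes a b :: real
  obtains c s where "a = sqrt (a\<^sup>2 + b\<^sup>2) * c" "b = sqrt (a\<^sup>2 + b\<^sup>2) * s" "c\<^sup>2 + s\<^sup>2 = 1"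
proof (cases "a\<^sup>2 + b\<^sup>2 = 0")
  case True
  then have "a = 0" "b = 0" by (auto simp: sum_power2_eq_zero_iff)
  then show ?thesis using that[of 1 0] by simp
next
  case False
  define r where "r = sqrt (a\<^sup>2 + b\<^sup>2)"
  have r2: "r\<^sup>2 = a\<^sup>2 + b\<^sup>2" by (simp add: r_def)
  with False have "r \<noteq> 0" by (metis zero_power2)
  moreover have "(a / r)\<^sup>2 + (b / r)\<^sup>2 = 1"
    using \<open>r \<noteq> 0\<close> by (simp add: power_divide add_divide_distrib[symmetric] r2[symmetric])
  ultimately show ?thesis
    using that[of "a / r" "b / r"] unfolding r_def[symmetric] by simp
qed

text \<open>Up to the factor \<open>sqrt (a\<^sup>2 + b\<^sup>2)\<close> the combination is the
  first coordinate of a rotated pair; after rotating, the second coordinate integrates to 1.\<close>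

lemma std_normal_linear_combination:
  assumes [measurable]: "h \<in> borel_measurable borel"
  shows "(\<integral>\<^sup>+x. \<integral>\<^sup>+y. h (a * x + b * y) \<partial>std_normal_distribution \<partial>std_normal_distribution)
    = (\<integral>\<^sup>+x. h (sqrt (a\<^sup>2 + b\<^sup>2) * x) \<partial>std_normal_distribution)"
proof -
  interpret N: prob_space std_normal_distribution by (rule prob_space_std_normal)
  obtain c s where ab: "a = sqrt (a\<^sup>2 + b\<^sup>2) * c" "b = sqrt (a\<^sup>2 + b\<^sup>2) * s" and cs: "c\<^sup>2 + s\<^sup>2 = 1"
    by (rule polar_coordinates)
  define r where "r = sqrt (a\<^sup>2 + b\<^sup>2)"
  have "(\<integral>\<^sup>+x. \<integral>\<^sup>+y. h (a * x + b * y) \<partial>std_normal_distribution \<partial>std_normal_distribution)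
    = (\<integral>\<^sup>+x. \<integral>\<^sup>+y. h (r * (c * x + s * y)) \<partial>std_normal_distribution \<partial>std_normal_distribution)"
  proof -
    have "a * x + b * y = r * (c * x + s * y)" for x y
      using ab unfolding r_def[symmetric] by (simp add: algebra_simps)
    then show ?thesis by simp
  qed
  also have "\<dots> = (\<integral>\<^sup>+x. \<integral>\<^sup>+y. h (r * x) \<partial>std_normal_distribution \<partial>std_normal_distribution)"
    by (rule std_normal_rotation[OF _ cs, of "\<lambda>x y. h (r * x)"]) measurable
  also have "\<dots> = (\<integral>\<^sup>+x. h (r * x) \<partial>std_normal_distribution)"
    using N.emeasure_space_1 by simp
  finally show ?thesis by (simp add: r_def)
qed

text \<open>
  The coefficients \<open>\<alpha>, \<beta>, \<gamma>\<close> form the Cholesky factor of the Gram matrix of \<open>u\<close> and \<open>v\<close>; adding a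
  coordinate updates it by two plane rotations.
\<close>

lemma gaussian_vector_pair_law:
  "\<exists>\<beta> \<gamma>. sqrt (\<Sum>i<d. (u i)\<^sup>2) * \<beta> = dotp d u v \<and> \<beta>\<^sup>2 + \<gamma>\<^sup>2 = (\<Sum>i<d. (v i)\<^sup>2) \<and> 0 \<le> \<gamma> \<and>
    (\<forall>f. case_prod f \<in> borel_measurable (borel \<Otimes>\<^sub>M borel) \<longrightarrow>
      (\<integral>\<^sup>+r. f (dotp d r u) (dotp d r v) \<partial>gaussian_vector d)
      = (\<integral>\<^sup>+x. \<integral>\<^sup>+y. (f (sqrt (\<Sum>i<d. (u i)\<^sup>2) * x) (\<beta> * x + \<gamma> * y) :: ennreal)
           \<partial>std_normal_distribution \<partial>std_normal_distribution))"
proof (induction d)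
  case 0
  interpret N: prob_space std_normal_distribution by (rule prob_space_std_normal)
  interpret G: prob_space "gaussian_vector 0"
    unfolding gaussian_vector_def by (intro prob_space_PiM prob_space_std_normal)
  show ?case
    by (intro exI[of _ 0]) (use N.emeasure_space_1 G.emeasure_space_1 in \<open>simp add: dotp_def\<close>)
next
  case (Suc d)
  interpret N: prob_space std_normal_distribution by (rule prob_space_std_normal)
  interpret NN: pair_sigma_finite std_normal_distribution std_normal_distribution
    by (simp add: pair_sigma_finite_def sigma_finite_std_normal)
  interpret P: product_sigma_finite "\<lambda>_::nat. std_normal_distribution"
    by (simp add: product_sigma_finite_def sigma_finite_std_normal)
  let ?N = std_normal_distribution
  define \<alpha> where "\<alpha> = sqrt (\<Sum>i<d. (u i)\<^sup>2)"
  define \<alpha>' where "\<alpha>' = sqrt (\<Sum>i<Suc d. (u i)\<^sup>2)"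
  have \<alpha>'_eq: "\<alpha>' = sqrt (\<alpha>\<^sup>2 + (u d)\<^sup>2)"
    by (simp add: \<alpha>'_def \<alpha>_def sum_nonneg)
  from Suc obtain \<beta> \<gamma> where IH: "\<alpha> * \<beta> = dotp d u v" "\<beta>\<^sup>2 + \<gamma>\<^sup>2 = (\<Sum>i<d. (v i)\<^sup>2)"
    "\<And>f. case_prod f \<in> borel_measurable (borel \<Otimes>\<^sub>M borel) \<Longrightarrow>
      (\<integral>\<^sup>+r. f (dotp d r u) (dotp d r v) \<partial>gaussian_vector d)
      = (\<integral>\<^sup>+x. \<integral>\<^sup>+y. (f (\<alpha> * x) (\<beta> * x + \<gamma> * y) :: ennreal) \<partial>?N \<partial>?N)"
    unfolding \<alpha>_def by blast
  \<comment> \<open>The first rotation takes (\<open>\<alpha>\<close>, \<open>u d\<close>) to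
    (\<open>\<alpha>'\<close>, 0), so the projection on \<open>u\<close> again depends on a single
    Gaussian coordinate.\<close>
  obtain c s where cs: "\<alpha> = \<alpha>' * c" "u d = \<alpha>' * s" "c\<^sup>2 + s\<^sup>2 = 1"
    using polar_coordinates[of \<alpha> "u d"] unfolding \<alpha>'_eq by metis
  \<comment> \<open>\<open>\<beta>'\<close> and \<open>\<eta>\<close> are the coordinates of
    (\<open>\<beta>\<close>, \<open>v d\<close>) in the rotated frame. The second rotation merges
    \<open>\<eta>\<close> with the old residue \<open>\<gamma>\<close> into
    \<open>\<gamma>'\<close>.\<close>
  define \<beta>' where "\<beta>' = \<beta> * c + v d * s"
  define \<eta> where "\<eta> = - \<beta> * s + v d * c"
  define \<gamma>' where "\<gamma>' = sqrt (\<gamma>\<^sup>2 + \<eta>\<^sup>2)"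
  have 1: "\<alpha>' * \<beta>' = dotp (Suc d) u v"
  proof -
    have "\<alpha>' * \<beta>' = (\<alpha>' * c) * \<beta> + (\<alpha>' * s) * v d" by (simp add: \<beta>'_def algebra_simps)
    then show ?thesis using IH(1) cs by (simp add: dotp_def)
  qed
  have 2: "\<beta>'\<^sup>2 + \<gamma>'\<^sup>2 = (\<Sum>i<Suc d. (v i)\<^sup>2)"
  proof -
    have "\<beta>'\<^sup>2 + \<eta>\<^sup>2 = (\<beta>\<^sup>2 + (v d)\<^sup>2) * (c\<^sup>2 + s\<^sup>2)"
      by (simp add: \<beta>'_def \<eta>_def algebra_simps power2_eq_square)
    then show ?thesis using IH(2) cs(3) by (simp add: \<gamma>'_def)
  qed
  have 3: "(\<integral>\<^sup>+r. f (dotp (Suc d) r u) (dotp (Suc d) r v) \<partial>gaussian_vector (Suc d))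
      = (\<integral>\<^sup>+x. \<integral>\<^sup>+y. f (\<alpha>' * x) (\<beta>' * x + \<gamma>' * y) \<partial>?N \<partial>?N)"
    if [measurable]: "case_prod f \<in> borel_measurable (borel \<Otimes>\<^sub>M borel)" for f :: "real \<Rightarrow> real \<Rightarrow> ennreal"
  proof -
    have [measurable]: "(\<lambda>r. f (dotp (Suc d) r u) (dotp (Suc d) r v))
        \<in> borel_measurable (Pi\<^sub>M (insert d {..<d}) (\<lambda>_. ?N))"
      unfolding dotp_def lessThan_Suc by measurable
    have "(\<integral>\<^sup>+r. f (dotp (Suc d) r u) (dotp (Suc d) r v) \<partial>gaussian_vector (Suc d))
      = (\<integral>\<^sup>+z. \<integral>\<^sup>+r. f (dotp (Suc d) (r(d := z)) u) (dotp (Suc d) (r(d := z)) v) \<partial>gaussian_vector d \<partial>?N)"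
      unfolding gaussian_vector_def lessThan_Suc by (subst P.product_nn_integral_insert_rev) auto
    also have "\<dots> = (\<integral>\<^sup>+z. \<integral>\<^sup>+r. f (dotp d r u + z * u d) (dotp d r v + z * v d) \<partial>gaussian_vector d \<partial>?N)"
      by (simp add: dotp_def)
    also have "\<dots> = (\<integral>\<^sup>+z. \<integral>\<^sup>+x. \<integral>\<^sup>+y. f (\<alpha> * x + z * u d) (\<beta> * x + \<gamma> * y + z * v d) \<partial>?N \<partial>?N \<partial>?N)"
      by (intro nn_integral_cong IH(3)) measurable
    \<comment> \<open>The new coordinate z moves next to x, so that the first rotation can act on
      the pair (x, z).\<close>
    also have "\<dots> = (\<integral>\<^sup>+x. \<integral>\<^sup>+z. \<integral>\<^sup>+y. f (\<alpha> * x + z * u d) (\<beta> * x + \<gamma> * y + z * v d) \<partial>?N \<partial>?N \<partial>?N)"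
      by (rule NN.Fubini') measurable
    also have "\<dots> = (\<integral>\<^sup>+x. \<integral>\<^sup>+z. \<integral>\<^sup>+y. f (\<alpha>' * (c * x + s * z))
         (\<beta>' * (c * x + s * z) + (\<eta> * (- s * x + c * z) + \<gamma> * y)) \<partial>?N \<partial>?N \<partial>?N)"
    proof -
      have "\<alpha> * x + z * u d = \<alpha>' * (c * x + s * z)" for x z
        by (simp add: cs algebra_simps)
      moreover have "\<beta> * x + \<gamma> * y + z * v d = \<beta>' * (c * x + s * z) + (\<eta> * (- s * x + c * z) + \<gamma> * y)" for x y z
      proof -
        have "\<beta>' * (c * x + s * z) + (\<eta> * (- s * x + c * z) + \<gamma> * y)
          = (c\<^sup>2 + s\<^sup>2) * (\<beta> * x + z * v d) + \<gamma> * y"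
          by (simp add: \<beta>'_def \<eta>_def algebra_simps power2_eq_square)
        then show ?thesis by (simp add: cs)
      qed
      ultimately show ?thesis by (simp only:)
    qed
    also have "\<dots> = (\<integral>\<^sup>+x. \<integral>\<^sup>+z. \<integral>\<^sup>+y. f (\<alpha>' * x) (\<beta>' * x + (\<eta> * z + \<gamma> * y)) \<partial>?N \<partial>?N \<partial>?N)"
      by (rule std_normal_rotation[OF _ cs(3),
            of "\<lambda>x z. \<integral>\<^sup>+y. f (\<alpha>' * x) (\<beta>' * x + (\<eta> * z + \<gamma> * y)) \<partial>?N"]) measurable
    also have "\<dots> = (\<integral>\<^sup>+x. \<integral>\<^sup>+y. f (\<alpha>' * x) (\<beta>' * x + \<gamma>' * y) \<partial>?N \<partial>?N)"
      unfolding \<gamma>'_def add.commute[of "\<gamma>\<^sup>2"]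
      by (intro nn_integral_cong std_normal_linear_combination) measurable
    finally show ?thesis .
  qed
  have "0 \<le> \<gamma>'" by (simp add: \<gamma>'_def)
  then show ?case using 1 2 3 unfolding \<alpha>'_def by blast
qed

section \<open>The collision probability of a hyperplane hash\<close>

lemma std_normal_AE_neq: "AE x in std_normal_distribution. x \<noteq> a"
  by (auto simp: AE_density AE_lborel_singleton intro!: AE_I2 eventually_mono[OF AE_lborel_singleton[of a]])

text \<open>In the coordinates \<open>(x, y / x)\<close> the Gaussian density of the plane integrates in closed form.\<close>

lemma std_normal_cone:
  "(\<integral>\<^sup>+x. \<integral>\<^sup>+y. indicator {p. 0 < fst p \<and> snd p \<le> - \<kappa> * fst p} (x, y)
      \<partial>std_normal_distribution \<partial>std_normal_distribution) = ennreal ((pi / 2 - arctan \<kappa>) / (2 * pi))"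
    (is "?L = _")
proof -
  let ?e = "\<lambda>x s::real. x * exp (- (x\<^sup>2 * (1 + s\<^sup>2)) / 2) / (2 * pi)"
  have "?L = (\<integral>\<^sup>+x. \<integral>\<^sup>+y. ennreal (exp (- (x\<^sup>2 + y\<^sup>2) / 2) / (2 * pi)) *
       indicator {p. 0 < fst p \<and> snd p \<le> - \<kappa> * fst p} (x, y) \<partial>lborel \<partial>lborel)"
    by (rule nn_integral_std_normal_pair) measurable
  \<comment> \<open>Substitution y = x * s with Jacobian x. The half-line for x may be closed
    because the factor x in \<open>?e\<close> vanishes at 0.\<close>
  also have "\<dots> = (\<integral>\<^sup>+x. \<integral>\<^sup>+s. ennreal (?e x s) * indicator {0..} x * indicator {..- \<kappa>} s \<partial>lborel \<partial>lborel)"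
  proof (rule nn_integral_cong)
    fix x :: real
    show "(\<integral>\<^sup>+y. ennreal (exp (- (x\<^sup>2 + y\<^sup>2) / 2) / (2 * pi)) *
       indicator {p. 0 < fst p \<and> snd p \<le> - \<kappa> * fst p} (x, y) \<partial>lborel) =
       (\<integral>\<^sup>+s. ennreal (?e x s) * indicator {0..} x * indicator {..- \<kappa>} s \<partial>lborel)"
    proof (cases "0 < x")
      case False
      then show ?thesis by (cases "x = 0") auto
    next
      case True
      have "(\<integral>\<^sup>+y. ennreal (exp (- (x\<^sup>2 + y\<^sup>2) / 2) / (2 * pi)) *
         indicator {p. 0 < fst p \<and> snd p \<le> - \<kappa> * fst p} (x, y) \<partial>lborel)
        = ennreal \<bar>x\<bar> * (\<integral>\<^sup>+s. ennreal (exp (- (x\<^sup>2 + (0 + x * s)\<^sup>2) / 2) / (2 * pi)) *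
         indicator {p. 0 < fst p \<and> snd p \<le> - \<kappa> * fst p} (x, 0 + x * s) \<partial>lborel)"
        using True by (intro nn_integral_real_affine) auto
      also have "\<dots> = (\<integral>\<^sup>+s. ennreal \<bar>x\<bar> * (ennreal (exp (- (x\<^sup>2 + (0 + x * s)\<^sup>2) / 2) / (2 * pi)) *
         indicator {p. 0 < fst p \<and> snd p \<le> - \<kappa> * fst p} (x, 0 + x * s)) \<partial>lborel)"
        by (subst nn_integral_cmult) auto
      also have "\<dots> = (\<integral>\<^sup>+s. ennreal (?e x s) * indicator {0..} x * indicator {..- \<kappa>} s \<partial>lborel)"
      proof (rule nn_integral_cong)
        fix s :: real
        have "x * s \<le> - \<kappa> * x \<longleftrightarrow> s \<le> - \<kappa>"
          using True mult_le_cancel_left_pos[of x s "- \<kappa>"] by (simp add: mult.commute)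
        moreover have "x\<^sup>2 + (x * s)\<^sup>2 = x\<^sup>2 * (1 + s\<^sup>2)"
          by (simp add: algebra_simps power_mult_distrib)
        ultimately show "ennreal \<bar>x\<bar> * (ennreal (exp (- (x\<^sup>2 + (0 + x * s)\<^sup>2) / 2) / (2 * pi)) *
           indicator {p. 0 < fst p \<and> snd p \<le> - \<kappa> * fst p} (x, 0 + x * s))
           = ennreal (?e x s) * indicator {0..} x * indicator {..- \<kappa>} s"
          using True by (simp add: indicator_def ennreal_mult[symmetric])
      qed
      finally show ?thesis .
    qed
  qed
  also have "\<dots> = (\<integral>\<^sup>+s. \<integral>\<^sup>+x. ennreal (?e x s) * indicator {0..} x * indicator {..- \<kappa>} s \<partial>lborel \<partial>lborel)"
    by (rule lborel_pair.Fubini') measurable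
  also have "\<dots> = (\<integral>\<^sup>+s. ennreal (1 / (2 * pi * (1 + s\<^sup>2))) * indicator {..- \<kappa>} s \<partial>lborel)"
  proof (rule nn_integral_cong)
    fix s :: real
    \<comment> \<open>For fixed s the factor x gained from the substitution makes the Gaussian
      integrand an exact derivative.\<close>
    let ?F = "\<lambda>x. - (exp (- (x\<^sup>2 * (1 + s\<^sup>2)) / 2) / (2 * pi * (1 + s\<^sup>2)))"
    have s: "1 + s\<^sup>2 > 0" by (simp add: add_pos_nonneg)
    have "(\<integral>\<^sup>+x. ennreal (?e x s) * indicator {0..} x \<partial>lborel) = ennreal (0 - ?F 0)"
    proof (rule nn_integral_FTC_atLeast)
      show "(?F has_real_derivative ?e x s) (at x)" for x
      proof -
        have "((\<lambda>x. - (exp (- (x\<^sup>2 * w) / 2) / (2 * pi * w))) has_real_derivative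
            x * exp (- (x\<^sup>2 * w) / 2) / (2 * pi)) (at x)" if "w > 0" for w
          using that by (auto intro!: derivative_eq_intros)
        from this[OF s] show ?thesis .
      qed
      have "filterlim (\<lambda>x::real. x\<^sup>2 * ((1 + s\<^sup>2) / 2)) at_top at_top"
        using s by (intro filterlim_at_top_mult_tendsto_pos[OF tendsto_const] filterlim_pow_at_top filterlim_ident) auto
      then have "filterlim (\<lambda>x::real. - (x\<^sup>2 * (1 + s\<^sup>2)) / 2) at_bot at_top"
        by (simp add: filterlim_uminus_at_bot)
      then have "((\<lambda>x::real. exp (- (x\<^sup>2 * (1 + s\<^sup>2)) / 2)) \<longlongrightarrow> 0) at_top"
        by (rule filterlim_compose[OF exp_at_bot])
      then have "((\<lambda>x::real. exp (- (x\<^sup>2 * (1 + s\<^sup>2)) / 2) / (2 * pi * (1 + s\<^sup>2))) \<longlongrightarrow> 0) at_top"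
        by (rule tendsto_divide_zero)
      then show "(?F \<longlongrightarrow> 0) at_top" using tendsto_minus by fastforce
    qed auto
    then show "(\<integral>\<^sup>+x. ennreal (?e x s) * indicator {0..} x * indicator {..- \<kappa>} s \<partial>lborel)
       = ennreal (1 / (2 * pi * (1 + s\<^sup>2))) * indicator {..- \<kappa>} s"
      by (subst nn_integral_multc) auto
  qed
  \<comment> \<open>The reflection of s turns the half-line into one unbounded above, as the
    fundamental theorem below requires.\<close>
  also have "\<dots> = (\<integral>\<^sup>+s. ennreal (1 / (2 * pi * (1 + s\<^sup>2))) * indicator {\<kappa>..} s \<partial>lborel)"
    by (subst nn_integral_lborel_uminus[symmetric]) (auto simp: indicator_def)
  also have "\<dots> = ennreal ((pi / 2) / (2 * pi) - arctan \<kappa> / (2 * pi))"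
  proof (rule nn_integral_FTC_atLeast)
    show "((\<lambda>s. arctan s / (2 * pi)) has_real_derivative 1 / (2 * pi * (1 + s\<^sup>2))) (at s)" for s
      by (rule DERIV_cong[OF DERIV_cdivide[OF DERIV_arctan]]) (simp add: inverse_eq_divide mult.commute)
    show "((\<lambda>s. arctan s / (2 * pi)) \<longlongrightarrow> (pi / 2) / (2 * pi)) at_top"
      by (intro tendsto_divide tendsto_arctan_at_top tendsto_const) simp
  qed (auto intro!: divide_nonneg_nonneg mult_nonneg_nonneg)
  finally show ?thesis by (simp only: diff_divide_distrib)
qed

text \<open>With \<beta> = cos \<theta> and \<gamma> = sin \<theta> the two linear forms differ in
  sign on a double cone. The antipodal map exchanges its halves, and \<open>std_normal_cone\<close>
  with \<kappa> = cot \<theta> gives each of them the mass \<theta> / (2 * pi).\<close>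

lemma std_normal_opposite_signs:
  assumes "\<beta>\<^sup>2 + \<gamma>\<^sup>2 = 1" "0 \<le> \<gamma>"
  shows "(\<integral>\<^sup>+x. \<integral>\<^sup>+y. indicator {p. (fst p \<le> 0) \<noteq> (\<beta> * fst p + \<gamma> * snd p \<le> 0)} (x, y)
      \<partial>std_normal_distribution \<partial>std_normal_distribution) = ennreal (arccos \<beta> / pi)"
    (is "?L = _")
proof (cases "\<gamma> = 0")
  \<comment> \<open>Parallel vectors, for which the slope \<open>\<kappa>\<close> does not exist.
    For \<beta> = -1 the signs differ everywhere except on the null line x = 0.\<close>
  case True
  interpret N: prob_space std_normal_distribution by (rule prob_space_std_normal)
  from True assms have "\<beta> = 1 \<or> \<beta> = -1" by (simp add: power2_eq_1_iff)
  then show ?thesis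
  proof
    assume "\<beta> = 1"
    then show ?thesis using True by simp
  next
    assume \<beta>: "\<beta> = -1"
    have "?L = (\<integral>\<^sup>+x. \<integral>\<^sup>+y. 1 \<partial>std_normal_distribution \<partial>std_normal_distribution)"
    proof (rule nn_integral_cong_AE)
      show "AE x in std_normal_distribution.
        (\<integral>\<^sup>+y. indicator {p. (fst p \<le> 0) \<noteq> (\<beta> * fst p + \<gamma> * snd p \<le> 0)} (x, y) \<partial>std_normal_distribution)
        = (\<integral>\<^sup>+y. 1 \<partial>std_normal_distribution)"
        using std_normal_AE_neq[of 0]
        by eventually_elim (intro nn_integral_cong, auto simp: True \<beta> indicator_def)
    qed
    then show ?thesis using N.emeasure_space_1 by (simp add: \<beta>)
  qed
next
  case False
  with assms have g: "\<gamma> > 0" by simp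
  interpret N: prob_space std_normal_distribution by (rule prob_space_std_normal)
  define \<kappa> where "\<kappa> = \<beta> / \<gamma>"
  let ?N = std_normal_distribution
  let ?c = "\<lambda>x y. indicator {p. 0 < fst p \<and> snd p \<le> - \<kappa> * fst p} (x, y) :: ennreal"
  let ?c' = "\<lambda>x y. indicator {p. fst p \<le> 0 \<and> \<beta> * fst p + \<gamma> * snd p > 0} (x, y) :: ennreal"
  have iff: "\<beta> * x + \<gamma> * y \<le> 0 \<longleftrightarrow> y \<le> - \<kappa> * x" for x y
  proof -
    have "\<beta> * x + \<gamma> * y \<le> 0 \<longleftrightarrow> \<gamma> * y \<le> \<gamma> * (- \<kappa> * x)" using g by (auto simp: \<kappa>_def)
    then show ?thesis using g by (simp only: mult_le_cancel_left_pos)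
  qed
  have "?L = (\<integral>\<^sup>+x. \<integral>\<^sup>+y. ?c x y + ?c' x y \<partial>?N \<partial>?N)"
    by (intro nn_integral_cong) (auto simp: indicator_def iff not_le simp flip: not_le)
  also have "\<dots> = (\<integral>\<^sup>+x. \<integral>\<^sup>+y. ?c x y \<partial>?N \<partial>?N) + (\<integral>\<^sup>+x. \<integral>\<^sup>+y. ?c' x y \<partial>?N \<partial>?N)"
    by (simp add: nn_integral_add)
  also have "(\<integral>\<^sup>+x. \<integral>\<^sup>+y. ?c' x y \<partial>?N \<partial>?N) = (\<integral>\<^sup>+x. \<integral>\<^sup>+y. ?c' (- x) (- y) \<partial>?N \<partial>?N)"
    using std_normal_rotation[of ?c' "-1" 0] by simp
  also have "\<dots> = (\<integral>\<^sup>+x. \<integral>\<^sup>+y. ?c x y \<partial>?N \<partial>?N)"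
  \<comment> \<open>Zero counts as nonpositive, so the sign regions are not symmetric under the
    antipodal map: the halves match only off x = 0 and \<open>y = - \<kappa> * x\<close>, which are
    null.\<close>
  proof (rule nn_integral_cong_AE)
    show "AE x in ?N. (\<integral>\<^sup>+y. ?c' (- x) (- y) \<partial>?N) = (\<integral>\<^sup>+y. ?c x y \<partial>?N)"
      using std_normal_AE_neq[of 0]
    proof eventually_elim
      case (elim x)
      have "AE y in ?N. ?c' (- x) (- y) = ?c x y"
        using std_normal_AE_neq[of "- \<kappa> * x"]
      proof eventually_elim
        case (elim y)
        have "\<beta> * (- x) + \<gamma> * (- y) > 0 \<longleftrightarrow> y < - \<kappa> * x"
          using iff[of "- x" "- y"] iff[of x y] elim by (auto simp: not_le)
        with elim \<open>x \<noteq> 0\<close> show ?case by (auto simp: indicator_def)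
      qed
      then show ?case by (rule nn_integral_cong_AE)
    qed
  qed
  finally have "?L = ennreal ((pi / 2 - arctan \<kappa>) / (2 * pi)) + ennreal ((pi / 2 - arctan \<kappa>) / (2 * pi))"
    unfolding std_normal_cone .
  also have "\<dots> = ennreal ((pi / 2 - arctan \<kappa>) / pi)"
    using arctan_ubound[of \<kappa>] by (subst ennreal_plus[symmetric]) (auto simp: field_simps)
  also have "pi / 2 - arctan \<kappa> = arccos \<beta>"
  proof -
    have b: "-1 \<le> \<beta>" "\<beta> \<le> 1" and "\<beta> \<noteq> 1" "\<beta> \<noteq> -1"
    proof -
      have "\<beta>\<^sup>2 \<le> 1" using assms zero_le_power2[of \<gamma>] by linarith
      then show "-1 \<le> \<beta>" "\<beta> \<le> 1" using abs_le_square_iff[of \<beta> 1] by auto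
      show "\<beta> \<noteq> 1" "\<beta> \<noteq> -1" using assms False by auto
    qed
    then have b': "-1 < \<beta>" "\<beta> < 1" by auto
    \<comment> \<open>Nonnegativity of \<gamma> selects the root of 1 - \<beta>^2, which makes
      \<kappa> the cotangent of the angle.\<close>
    have "sin (arccos \<beta>) = \<gamma>"
      using b assms by (simp add: sin_arccos) (metis add_diff_cancel_left' real_sqrt_abs abs_of_nonneg)
    then have "tan (pi / 2 - arccos \<beta>) = \<kappa>"
      using b by (simp add: tan_def sin_diff cos_diff \<kappa>_def)
    then have "arctan \<kappa> = pi / 2 - arccos \<beta>"
      using arccos_lt_bounded[OF b'] by (intro arctan_unique) auto
    then show ?thesis by simp
  qed
  finally show ?thesis .
qed

lemma hash_bit_measurable [measurable]:
  "(\<lambda>r. hash_bit d r v) \<in> gaussian_vector d \<rightarrow>\<^sub>M count_space UNIV"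
  unfolding hash_bit_def dotp_def gaussian_vector_def by measurable

text \<open>In every dimension the two projections are distributed as x and \<beta> * x + \<gamma> *
  y with \<beta> the inner product, so separation becomes an event in the Gaussian plane.\<close>

lemma prob_hash_bit_neq:
  assumes "u \<in> unit_vectors d" "v \<in> unit_vectors d"
  shows "emeasure (gaussian_vector d) {r \<in> space (gaussian_vector d). hash_bit d r u \<noteq> hash_bit d r v}
    = ennreal (angle d u v / pi)"
proof -
  have un: "sqrt (\<Sum>i<d. (u i)\<^sup>2) = 1" and vn: "(\<Sum>i<d. (v i)\<^sup>2) = 1"
    using assms by (auto simp: unit_vectors_def L2_set_def)
  obtain \<beta> \<gamma> where law: "\<beta> = dotp d u v" "\<beta>\<^sup>2 + \<gamma>\<^sup>2 = 1" "0 \<le> \<gamma>"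
    "\<And>f. case_prod f \<in> borel_measurable (borel \<Otimes>\<^sub>M borel) \<Longrightarrow>
      (\<integral>\<^sup>+r. f (dotp d r u) (dotp d r v) \<partial>gaussian_vector d)
      = (\<integral>\<^sup>+x. \<integral>\<^sup>+y. (f x (\<beta> * x + \<gamma> * y) :: ennreal) \<partial>std_normal_distribution \<partial>std_normal_distribution)"
    using gaussian_vector_pair_law[where d = d and u = u and v = v] unfolding un vn by auto
  let ?f = "\<lambda>a b. indicator {p. (fst p \<le> 0) \<noteq> (snd p \<le> 0)} (a, b) :: ennreal"
  have "emeasure (gaussian_vector d) {r \<in> space (gaussian_vector d). hash_bit d r u \<noteq> hash_bit d r v}
    = (\<integral>\<^sup>+r. indicator {r \<in> space (gaussian_vector d). hash_bit d r u \<noteq> hash_bit d r v} r \<partial>gaussian_vector d)"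
    by (rule nn_integral_indicator[symmetric]) measurable
  also have "\<dots> = (\<integral>\<^sup>+r. ?f (dotp d r u) (dotp d r v) \<partial>gaussian_vector d)"
    by (intro nn_integral_cong) (auto simp: indicator_def hash_bit_def)
  also have "\<dots> = (\<integral>\<^sup>+x. \<integral>\<^sup>+y. ?f x (\<beta> * x + \<gamma> * y) \<partial>std_normal_distribution \<partial>std_normal_distribution)"
    by (rule law(4)) measurable
  also have "\<dots> = (\<integral>\<^sup>+x. \<integral>\<^sup>+y. indicator {p. (fst p \<le> 0) \<noteq> (\<beta> * fst p + \<gamma> * snd p \<le> 0)} (x, y)
      \<partial>std_normal_distribution \<partial>std_normal_distribution)"
    by (intro nn_integral_cong) (auto simp: indicator_def)
  also have "\<dots> = ennreal (angle d u v / pi)"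
    unfolding std_normal_opposite_signs[OF law(2,3)] by (simp add: angle_def law(1))
  finally show ?thesis .
qed

section \<open>Product measures\<close>

text \<open>The event is split by the exact set \<open>J\<close> of coordinates satisfying
  \<open>E\<close>. Each cell is a box whose mass depends only on the size of \<open>J\<close>;
  grouping by size gives the binomial sum.\<close>

lemma prob_card_hits:
  fixes M :: "'a measure"
  assumes "prob_space M" and E[measurable]: "Measurable.pred M E" and p: "p = measure M {x \<in> space M. E x}"
    and I: "I \<subseteq> {0..t}"
  shows "measure (Pi\<^sub>M {..<t} (\<lambda>_. M)) {r \<in> space (Pi\<^sub>M {..<t} (\<lambda>_. M)). card {j \<in> {..<t}. E (r j)} \<in> I}
    = (\<Sum>i\<in>I. real (t choose i) * (1 - p) ^ (t - i) * p ^ i)"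
proof -
  interpret M: prob_space M by fact
  interpret P: finite_product_prob_space "\<lambda>_. M" "{..<t}"
    by (simp add: finite_product_prob_space_def finite_product_sigma_finite_def product_sigma_finite_def
        M.sigma_finite_measure_axioms product_prob_space_def product_prob_space_axioms_def
        finite_product_sigma_finite_axioms_def M.prob_space_axioms)
  let ?P = "Pi\<^sub>M {..<t} (\<lambda>_. M)"
  define X where "X = {x \<in> space M. E x}"
  have X[measurable]: "X \<in> sets M" unfolding X_def by measurable
  define A where "A J = (\<Pi>\<^sub>E j\<in>{..<t}. if j \<in> J then X else space M - X)" for J
  define \<J> where "\<J> = {J. J \<subseteq> {..<t} \<and> card J \<in> I}"
  have fin: "finite \<J>" unfolding \<J>_def by (rule finite_subset[of _ "Pow {..<t}"]) auto
  have finI: "finite I" using I finite_subset by blast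
  have A_iff: "r \<in> A J \<longleftrightarrow> r \<in> space ?P \<and> {j \<in> {..<t}. E (r j)} = J" if "J \<subseteq> {..<t}" for r J
    using that unfolding A_def X_def space_PiM PiE_iff
    by (auto simp: subset_eq split: if_splits)
  have "{r \<in> space ?P. card {j \<in> {..<t}. E (r j)} \<in> I} = (\<Union>J\<in>\<J>. A J)"
    by (auto simp: A_iff \<J>_def)
  also have "measure ?P \<dots> = (\<Sum>J\<in>\<J>. measure ?P (A J))"
  proof (rule P.finite_measure_finite_Union[OF fin])
    show "A ` \<J> \<subseteq> sets ?P" unfolding A_def by (auto intro!: sets_PiM_I_finite)
    show "disjoint_family_on A \<J>"
      unfolding disjoint_family_on_def by (auto simp: \<J>_def A_iff)
  qed
  also have "\<dots> = (\<Sum>J\<in>\<J>. p ^ card J * (1 - p) ^ (t - card J))"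
  proof (rule sum.cong[OF refl])
    fix J assume "J \<in> \<J>"
    then have J: "J \<subseteq> {..<t}" by (simp add: \<J>_def)
    have "measure ?P (A J) = (\<Prod>j<t. measure M (if j \<in> J then X else space M - X))"
      unfolding A_def by (rule P.prob_times) auto
    also have "\<dots> = (\<Prod>j<t. if j \<in> J then p else 1 - p)"
      by (intro prod.cong refl) (auto simp: M.prob_compl p X_def[symmetric])
    also have "\<dots> = p ^ card J * (1 - p) ^ (t - card J)"
    proof -
      have "{..<t} \<inter> {j. j \<in> J} = J" "{..<t} \<inter> - {j. j \<in> J} = {..<t} - J" using J by auto
      then show ?thesis using J by (simp add: prod.If_cases card_Diff_subset finite_subset[OF J])
    qed
    finally show "measure ?P (A J) = p ^ card J * (1 - p) ^ (t - card J)" .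
  qed
  also have "\<dots> = (\<Sum>i\<in>I. \<Sum>J\<in>{J\<in>\<J>. card J = i}. p ^ card J * (1 - p) ^ (t - card J))"
    by (rule sum.group[symmetric, OF fin finI]) (auto simp: \<J>_def)
  also have "\<dots> = (\<Sum>i\<in>I. real (t choose i) * (1 - p) ^ (t - i) * p ^ i)"
  proof (rule sum.cong[OF refl])
    fix i assume "i \<in> I"
    then have "{J\<in>\<J>. card J = i} = {J. J \<subseteq> {..<t} \<and> card J = i}" by (auto simp: \<J>_def)
    then have "card {J\<in>\<J>. card J = i} = t choose i" by (simp add: n_subsets)
    then show "(\<Sum>J\<in>{J\<in>\<J>. card J = i}. p ^ card J * (1 - p) ^ (t - card J))
      = real (t choose i) * (1 - p) ^ (t - i) * p ^ i"
      by (simp add: mult_ac)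
  qed
  finally show ?thesis .
qed

section \<open>Moments of sums over independent tables\<close>

context
  fixes M :: "'a measure" and K :: nat and f h :: "'a \<Rightarrow> real" and B :: real
  assumes M: "prob_space M"
    and f[measurable]: "f \<in> borel_measurable M" and h[measurable]: "h \<in> borel_measurable M"
    and f_bound: "\<And>x. x \<in> space M \<Longrightarrow> \<bar>f x\<bar> \<le> B" and h_bound: "\<And>x. x \<in> space M \<Longrightarrow> \<bar>h x\<bar> \<le> B"
begin

interpretation M: prob_space M by (rule M)

interpretation P: finite_product_prob_space "\<lambda>_. M" "{..<K}"
  by (simp add: finite_product_prob_space_def finite_product_sigma_finite_def product_sigma_finite_def
        M.sigma_finite_measure_axioms product_prob_space_def product_prob_space_axioms_def
        finite_product_sigma_finite_axioms_def M.prob_space_axioms)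

lemma integrable_PiM_component_mult:
  assumes "k < K" "l < K"
  shows "integrable (Pi\<^sub>M {..<K} (\<lambda>_. M)) (\<lambda>R. f (R k) * h (R l))"
proof (rule P.integrable_const_bound[where B = "B * B"])
  have [measurable]: "(\<lambda>R. R k) \<in> Pi\<^sub>M {..<K} (\<lambda>_. M) \<rightarrow>\<^sub>M M" "(\<lambda>R. R l) \<in> Pi\<^sub>M {..<K} (\<lambda>_. M) \<rightarrow>\<^sub>M M"
    using assms by auto
  show "(\<lambda>R. f (R k) * h (R l)) \<in> borel_measurable (Pi\<^sub>M {..<K} (\<lambda>_. M))" by measurable
  show "AE R in Pi\<^sub>M {..<K} (\<lambda>_. M). norm (f (R k) * h (R l)) \<le> B * B"
  proof (rule AE_I2)
    fix R assume "R \<in> space (Pi\<^sub>M {..<K} (\<lambda>_. M))"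
    then have "R k \<in> space M" "R l \<in> space M" using assms by (auto simp: space_PiM)
    then show "norm (f (R k) * h (R l)) \<le> B * B"
      using f_bound h_bound unfolding real_norm_def abs_mult
      by (intro mult_mono) (auto intro: order_trans[OF abs_ge_zero])
  qed
qed

lemma integral_PiM_component_mult:
  assumes "k < K" "l < K"
  shows "(\<integral>R. f (R k) * h (R l) \<partial>Pi\<^sub>M {..<K} (\<lambda>_. M)) =
    (if k = l then \<integral>x. f x * h x \<partial>M else (\<integral>x. f x \<partial>M) * (\<integral>x. h x \<partial>M))"
proof (cases "k = l")
  case True
  have "(\<integral>R. f (R k) * h (R k) \<partial>Pi\<^sub>M {..<K} (\<lambda>_. M))
      = (\<integral>x. f x * h x \<partial>distr (Pi\<^sub>M {..<K} (\<lambda>_. M)) M (\<lambda>R. R k))"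
    using assms by (subst integral_distr) auto
  also have "distr (Pi\<^sub>M {..<K} (\<lambda>_. M)) M (\<lambda>R. R k) = M"
    using assms M by (intro distr_PiM_component) auto
  finally show ?thesis using True by simp
next
  case False
  \<comment> \<open>Padding with the constant 1 writes the product of two coordinates as a product
    over all \<open>K\<close> coordinates, which the product measure factorizes.\<close>
  define g where "g i x = (if i = k then f x else 1) * (if i = l then h x else 1)" for i x
  have if_f: "integrable M f" using f_bound by (intro M.integrable_const_bound[where B = B]) auto
  have if_h: "integrable M h" using h_bound by (intro M.integrable_const_bound[where B = B]) auto
  have g: "integrable M (g i)" for i
    using False if_f if_h by (cases "i = k"; cases "i = l") (simp_all add: g_def[abs_def])
  have Ig: "integral\<^sup>L M (g i) = (if i = k then \<integral>x. f x \<partial>M else 1) * (if i = l then \<integral>x. h x \<partial>M else 1)" for i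
    using False by (cases "i = k"; cases "i = l") (simp_all add: g_def[abs_def] M.prob_space)
  have "(\<integral>R. f (R k) * h (R l) \<partial>Pi\<^sub>M {..<K} (\<lambda>_. M)) = (\<integral>R. (\<Prod>i<K. g i (R i)) \<partial>Pi\<^sub>M {..<K} (\<lambda>_. M))"
    using assms by (simp add: g_def prod.distrib)
  also have "\<dots> = (\<Prod>i<K. integral\<^sup>L M (g i))"
    by (rule P.product_integral_prod) (auto simp: g)
  also have "\<dots> = (\<integral>x. f x \<partial>M) * (\<integral>x. h x \<partial>M)"
    using assms by (simp add: Ig prod.distrib)
  finally show ?thesis using False by simp
qed

lemma integrable_PiM_sum_mult:
  "integrable (Pi\<^sub>M {..<K} (\<lambda>_. M)) (\<lambda>R. (\<Sum>k<K. f (R k)) * (\<Sum>l<K. h (R l)))"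
  unfolding sum_product by (intro Bochner_Integration.integrable_sum integrable_PiM_component_mult) auto

text \<open>The \<open>K\<close> diagonal pairs share a table, the other \<open>K * (K - 1)\<close>
  are independent. Two functions are allowed because bucket sizes are later multiplied with weighted
  hits, and these depend on each other inside one table.\<close>

lemma integral_PiM_sum_mult:
  "(\<integral>R. (\<Sum>k<K. f (R k)) * (\<Sum>l<K. h (R l)) \<partial>Pi\<^sub>M {..<K} (\<lambda>_. M)) =
    real K * (\<integral>x. f x * h x \<partial>M) + real K * (real K - 1) * ((\<integral>x. f x \<partial>M) * (\<integral>x. h x \<partial>M))"
proof -
  let ?a = "\<integral>x. f x * h x \<partial>M" and ?b = "(\<integral>x. f x \<partial>M) * (\<integral>x. h x \<partial>M)"
  have "(\<integral>R. (\<Sum>k<K. f (R k)) * (\<Sum>l<K. h (R l)) \<partial>Pi\<^sub>M {..<K} (\<lambda>_. M))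
    = (\<Sum>k<K. \<Sum>l<K. \<integral>R. f (R k) * h (R l) \<partial>Pi\<^sub>M {..<K} (\<lambda>_. M))"
    unfolding sum_product
    by (subst Bochner_Integration.integral_sum, fastforce intro: Bochner_Integration.integrable_sum integrable_PiM_component_mult)
       (intro sum.cong refl Bochner_Integration.integral_sum integrable_PiM_component_mult; simp)
  also have "\<dots> = (\<Sum>k<K. \<Sum>l<K. ?b + (if k = l then ?a - ?b else 0))"
    by (intro sum.cong refl) (simp add: integral_PiM_component_mult)
  also have "\<dots> = real K * ?a + real K * (real K - 1) * ?b"
    by (simp add: sum.distrib algebra_simps)
  finally show ?thesis .
qed

end

lemma integral_PiM_sum:
  fixes M :: "'a measure" and f :: "'a \<Rightarrow> real"
  assumes "prob_space M" and f: "integrable M f"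
  shows "(\<integral>R. (\<Sum>k<K. f (R k)) \<partial>Pi\<^sub>M {..<K} (\<lambda>_. M)) = real K * (\<integral>x. f x \<partial>M)"
proof -
  have distr: "distr (Pi\<^sub>M {..<K} (\<lambda>_. M)) M (\<lambda>R. R k) = M" if "k < K" for k
    using that assms by (intro distr_PiM_component) auto
  have [measurable]: "(\<lambda>R. R k) \<in> Pi\<^sub>M {..<K} (\<lambda>_. M) \<rightarrow>\<^sub>M M" if "k < K" for k
    using that by auto
  have "integrable (Pi\<^sub>M {..<K} (\<lambda>_. M)) (\<lambda>R. f (R k))" if "k < K" for k
    using that f by (subst integrable_distr_eq[of _ _ M, symmetric]) (auto simp: distr)
  moreover have "(\<integral>R. f (R k) \<partial>Pi\<^sub>M {..<K} (\<lambda>_. M)) = (\<integral>x. f x \<partial>M)" if "k < K" for k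
    using that f by (subst integral_distr[of _ _ M, symmetric]) (auto simp: distr)
  ultimately show ?thesis by simp
qed

section \<open>Medians and means of samples\<close>

text \<open>In a sorted list the elements with a downward closed property form a prefix. This turns
  statements about order statistics into counts over the unsorted list.\<close>

lemma nth_sort_downclosed_iff:
  fixes xs :: "'a::linorder list"
  assumes k: "k < length xs" and P: "\<And>x y. x \<le> y \<Longrightarrow> P y \<Longrightarrow> P x"
  shows "P (sort xs ! k) \<longleftrightarrow> k < length (filter P xs)"
proof -
  let ?ys = "sort xs" and ?H = "{i. i < length xs \<and> P (sort xs ! i)}"
  have len: "length (filter P xs) = card ?H"
  proof -
    have "length (filter P xs) = length (filter P ?ys)"
      by (metis mset_filter mset_sort size_mset)
    then show ?thesis by (simp add: length_filter_conv_card)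
  qed
  show ?thesis
  proof
    assume "P (?ys ! k)"
    then have "{..k} \<subseteq> ?H"
      using k by (auto intro: P[OF sorted_nth_mono[OF sorted_sort]])
    then have "card {..k} \<le> card ?H" by (intro card_mono) auto
    then show "k < length (filter P xs)" using len by simp
  next
    assume *: "k < length (filter P xs)"
    show "P (?ys ! k)"
    proof (rule ccontr)
      assume neg: "\<not> P (?ys ! k)"
      have "?H \<subseteq> {..<k}"
      proof
        fix i assume i: "i \<in> ?H"
        have "\<not> k \<le> i"
        proof
          assume "k \<le> i"
          then have "?ys ! k \<le> ?ys ! i" using i by (intro sorted_nth_mono) auto
          then show False using neg i P by blast
        qed
        then show "i \<in> {..<k}" by simp
      qed
      then have "card ?H \<le> card {..<k}" by (intro card_mono) auto
      then show False using * len by simp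
    qed
  qed
qed

lemma length_filter_map_upt:
  "real (length (filter P (map Y [0..<m]))) = (\<Sum>i<m. if P (Y i) then 1 else 0)"
proof -
  have "length (filter P (map Y [0..<m])) = card {i \<in> {..<m}. P (Y i)}"
    by (simp add: length_filter_conv_card cong: conj_cong)
  then show ?thesis by (simp add: sum.If_cases Int_def)
qed

text \<open>If fewer than half of the values lie outside the interval, then both middle order
  statistics, and hence their average, lie inside.\<close>

lemma median_outside:
  assumes m: "m > 0" and out: "median (map Y [0..<m]) \<notin> {a..b}"
  shows "real m / 2 \<le> (\<Sum>i<m. indicator (- {a..b}) (Y i))"
proof (rule ccontr)
  let ?xs = "map Y [0..<m]"
  let ?s = "\<Sum>i<m. indicator (- {a..b}) (Y i) :: real"
  assume "\<not> real m / 2 \<le> ?s"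
  then have s: "?s < real m / 2" by simp
  \<comment> \<open>More than m/2 values are at most \<open>b\<close>, hence more than k of
    them.\<close>
  have ub: "sort ?xs ! k \<le> b" if k: "2 * k \<le> m" "k < m" for k
  proof -
    have "real m = (\<Sum>i<m. 1)" by simp
    also have "\<dots> \<le> (\<Sum>i<m. (if Y i \<le> b then 1 else 0) + indicator (- {a..b}) (Y i))"
      by (intro sum_mono) (auto simp: indicator_def)
    also have "\<dots> = real (length (filter (\<lambda>x. x \<le> b) ?xs)) + ?s"
      unfolding length_filter_map_upt by (simp add: sum.distrib)
    finally have "k < length (filter (\<lambda>x. x \<le> b) ?xs)" using s k by linarith
    then show ?thesis using nth_sort_downclosed_iff[of k ?xs "\<lambda>x. x \<le> b"] k by simp
  qed
  \<comment> \<open>Fewer than m/2 values lie below \<open>a\<close>, hence at most k of them. The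
    slack 2 is attained by the lower middle index when m is even.\<close>
  have lb: "a \<le> sort ?xs ! k" if k: "m \<le> 2 * k + 2" "k < m" for k
  proof -
    have "real (length (filter (\<lambda>x. x < a) ?xs)) \<le> ?s"
      unfolding length_filter_map_upt by (intro sum_mono) (auto simp: indicator_def)
    then have "\<not> k < length (filter (\<lambda>x. x < a) ?xs)" using s k by linarith
    then have "\<not> sort ?xs ! k < a" using nth_sort_downclosed_iff[of k ?xs "\<lambda>x. x < a"] k by simp
    then show ?thesis by simp
  qed
  have "(m - 1) div 2 < m" "m div 2 < m" "2 * ((m - 1) div 2) \<le> m" "2 * (m div 2) \<le> m"
    "m \<le> 2 * ((m - 1) div 2) + 2" "m \<le> 2 * (m div 2) + 2" using m by auto
  then have "a \<le> median ?xs" "median ?xs \<le> b"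
    using ub[of "(m - 1) div 2"] ub[of "m div 2"] lb[of "(m - 1) div 2"] lb[of "m div 2"]
    by (auto simp: median_def)
  with out show False by simp
qed

text \<open>The k-th smallest value is at most a exactly if more than k coordinates are, and such a
  count is measurable.\<close>

lemma median_measurable:
  assumes N[measurable_cong]: "sets N = sets borel"
  shows "(\<lambda>Y. median (map Y [0..<m])) \<in> borel_measurable (Pi\<^sub>M {..<m} (\<lambda>_. N))"
proof (cases "m = 0")
  case True
  then show ?thesis by simp
next
  case False
  have nth: "(\<lambda>Y. sort (map Y [0..<m]) ! k) \<in> borel_measurable (Pi\<^sub>M {..<m} (\<lambda>_. N))" if "k < m" for k
    unfolding borel_measurable_iff_le
  proof
    fix a
    have comp[measurable]: "(\<lambda>Y. Y i) \<in> borel_measurable (Pi\<^sub>M {..<m} (\<lambda>_. N))" if "i < m" for i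
      using measurable_component_singleton[of i "{..<m}" "\<lambda>_. N"] that
      by (simp add: measurable_cong_sets[OF refl N])
    have "{Y \<in> space (Pi\<^sub>M {..<m} (\<lambda>_. N)). sort (map Y [0..<m]) ! k \<le> a} =
      {Y \<in> space (Pi\<^sub>M {..<m} (\<lambda>_. N)). real k < (\<Sum>i<m. if Y i \<le> a then 1 else 0)}"
      using \<open>k < m\<close> nth_sort_downclosed_iff[of k "map _ [0..<m]" "\<lambda>x. x \<le> a"]
      unfolding length_filter_map_upt[symmetric, of "\<lambda>x. x \<le> a"] by auto
    also have "\<dots> \<in> sets (Pi\<^sub>M {..<m} (\<lambda>_. N))" by measurable
    finally show "{Y \<in> space (Pi\<^sub>M {..<m} (\<lambda>_. N)). sort (map Y [0..<m]) ! k \<le> a}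
      \<in> sets (Pi\<^sub>M {..<m} (\<lambda>_. N))" .
  qed
  have [measurable]: "(\<lambda>Y. sort (map Y [0..<m]) ! ((m - 1) div 2)) \<in> borel_measurable (Pi\<^sub>M {..<m} (\<lambda>_. N))"
    "(\<lambda>Y. sort (map Y [0..<m]) ! (m div 2)) \<in> borel_measurable (Pi\<^sub>M {..<m} (\<lambda>_. N))"
    using False by (auto intro!: nth)
  show ?thesis unfolding median_def length_map length_upt diff_zero by measurable
qed

text \<open>The indicators of the failing copies have mean at most 1/4, while a failing median makes
  their sum at least m/2. Hoeffding's inequality with gap m/4 gives the exponent 2 * (m/4)^2 / m =
  m/8.\<close>

lemma median_boosting:
  assumes N: "prob_space N" and sets_N[measurable_cong]: "sets N = sets borel"
    and fail: "measure N (- {a..b}) \<le> 1 / 4" and m: "m > 0"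
  shows "1 - exp (- real m / 8)
    \<le> measure (distr (Pi\<^sub>M {..<m} (\<lambda>_. N)) borel (\<lambda>Y. median (map Y [0..<m]))) {a..b}"
proof -
  interpret N: prob_space N by fact
  let ?P = "Pi\<^sub>M {..<m} (\<lambda>_. N)"
  interpret P: prob_space ?P by (intro prob_space_PiM N)
  define X where "X i Y = (indicator (- {a..b}) (Y i) :: real)" for i :: nat and Y :: "nat \<Rightarrow> real"
  have comp: "(\<lambda>Y. Y i) \<in> ?P \<rightarrow>\<^sub>M N" if "i < m" for i using that by auto
  have distr: "distr ?P N (\<lambda>Y. Y i) = N" if "i < m" for i
    using that N by (intro distr_PiM_component) auto
  have "P.indep_vars (\<lambda>_. N) (\<lambda>i Y. Y i) {..<m}"
  proof (subst P.indep_vars_iff_distr_eq_PiM')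
    have "distr ?P ?P (\<lambda>Y. \<lambda>i\<in>{..<m}. Y i) = distr ?P ?P (\<lambda>Y. Y)"
      by (intro distr_cong refl) (auto simp: space_PiM)
    moreover have "Pi\<^sub>M {..<m} (\<lambda>i. distr ?P N (\<lambda>Y. Y i)) = ?P"
      by (intro PiM_cong refl) (simp add: distr)
    ultimately show "distr ?P ?P (\<lambda>Y. \<lambda>i\<in>{..<m}. Y i) = Pi\<^sub>M {..<m} (\<lambda>i. distr ?P N (\<lambda>Y. Y i))"
      by simp
  qed (use m in auto)
  then have indep: "P.indep_vars (\<lambda>_. borel) X {..<m}"
    unfolding X_def by (rule P.indep_vars_compose2) measurable
  interpret H: Hoeffding_ineq ?P "{..<m}" X "\<lambda>_. 0" "\<lambda>_. 1" "\<Sum>i<m. P.expectation (X i)"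
    by unfold_locales (auto simp: indep X_def indicator_def)
  have E: "P.expectation (X i) \<le> 1 / 4" if "i < m" for i
  proof -
    have "P.expectation (X i) = (\<integral>y. indicator (- {a..b}) y \<partial>distr ?P N (\<lambda>Y. Y i))"
      unfolding X_def using comp[OF that] by (subst integral_distr) auto
    also have "\<dots> \<le> 1 / 4" using fail that
      by (simp add: distr sets_eq_imp_space_eq[OF sets_N])
    finally show ?thesis .
  qed
  have mu: "(\<Sum>i<m. P.expectation (X i)) \<le> real m / 4"
    using sum_mono[of "{..<m}" "\<lambda>i. P.expectation (X i)" "\<lambda>_. 1 / 4"] E by simp
  note [measurable] = median_measurable[OF sets_N]
  let ?F = "{Y \<in> space ?P. median (map Y [0..<m]) \<notin> {a..b}}"
  have F[measurable]: "?F \<in> sets ?P" by measurable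
  have "P.prob ?F \<le> P.prob {Y \<in> space ?P. (\<Sum>i<m. P.expectation (X i)) + real m / 4 \<le> (\<Sum>i<m. X i Y)}"
  proof (rule P.finite_measure_mono)
    show "?F \<subseteq> {Y \<in> space ?P. (\<Sum>i<m. P.expectation (X i)) + real m / 4 \<le> (\<Sum>i<m. X i Y)}"
      using median_outside[OF m] mu unfolding X_def by fastforce
    show "{Y \<in> space ?P. (\<Sum>i<m. P.expectation (X i)) + real m / 4 \<le> (\<Sum>i<m. X i Y)} \<in> P.events"
      using H.random_variable by measurable
  qed
  also have "\<dots> \<le> exp (- 2 * (real m / 4)\<^sup>2 / (\<Sum>i<m. (1 - 0)\<^sup>2))"
    by (rule H.Hoeffding_ineq_ge) (use m in auto)
  also have "\<dots> = exp (- real m / 8)"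
    using m by (simp add: power2_eq_square field_simps)
  finally have "P.prob ?F \<le> exp (- real m / 8)" .
  moreover have "measure (distr ?P borel (\<lambda>Y. median (map Y [0..<m]))) {a..b} = 1 - P.prob ?F"
  proof -
    have "measure (distr ?P borel (\<lambda>Y. median (map Y [0..<m]))) {a..b} = P.prob (space ?P - ?F)"
      by (subst measure_distr) (auto intro!: arg_cong[where f = P.prob])
    then show ?thesis using P.prob_compl[OF F] by simp
  qed
  ultimately show ?thesis by simp
qed

text \<open>
  The shift \<open>c\<close> is arbitrary so that the induction can absorb the first sample into it.
\<close>

lemma nn_integral_replicate_pmf_square:
  fixes f :: "'a \<Rightarrow> real"
  assumes "finite (set_pmf p)"
  shows "(\<integral>\<^sup>+xs. ennreal (((\<Sum>x\<leftarrow>xs. f x) - c)\<^sup>2) \<partial>replicate_pmf n p) =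
    ennreal (real n * measure_pmf.variance p f + (real n * measure_pmf.expectation p f - c)\<^sup>2)"
proof (induction n arbitrary: c)
  case 0
  then show ?case by (simp add: power2_eq_square)
next
  case (Suc n)
  let ?E = "measure_pmf.expectation p f" and ?V = "measure_pmf.variance p f"
  have int: "integrable (measure_pmf p) g" for g :: "'a \<Rightarrow> real"
    by (rule integrable_measure_pmf_finite[OF assms])
  have V: "0 \<le> ?V" by (intro integral_nonneg_AE) auto
  have "(\<integral>\<^sup>+xs. ennreal (((\<Sum>x\<leftarrow>xs. f x) - c)\<^sup>2) \<partial>replicate_pmf (Suc n) p) =
    (\<integral>\<^sup>+x. \<integral>\<^sup>+xs. ennreal (((\<Sum>x\<leftarrow>xs. f x) - (c - f x))\<^sup>2) \<partial>replicate_pmf n p \<partial>p)"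
    by (simp add: algebra_simps)
  also have "\<dots> = (\<integral>\<^sup>+x. ennreal (real n * ?V + (real n * ?E - (c - f x))\<^sup>2) \<partial>p)"
    by (subst Suc) simp
  also have "\<dots> = ennreal (\<integral>x. real n * ?V + (real n * ?E - (c - f x))\<^sup>2 \<partial>p)"
    using V by (intro nn_integral_eq_integral int) (auto intro!: add_nonneg_nonneg mult_nonneg_nonneg)
  \<comment> \<open>Expanding around the mean makes the cross term linear in
    \<open>f x - ?E\<close>, so that it integrates to 0.\<close>
  also have "(\<integral>x. real n * ?V + (real n * ?E - (c - f x))\<^sup>2 \<partial>p)
    = (\<integral>x. (f x - ?E)\<^sup>2 + (2 * ((real n + 1) * ?E - c)) * (f x - ?E)
        + (real n * ?V + ((real n + 1) * ?E - c)\<^sup>2) \<partial>p)"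
    by (intro arg_cong[where f = "measure_pmf.expectation p"] ext)
       (simp add: power2_eq_square algebra_simps)
  also have "\<dots> = ?V + (2 * ((real n + 1) * ?E - c)) * (?E - ?E)
        + (real n * ?V + ((real n + 1) * ?E - c)\<^sup>2)"
    by (simp add: int)
  also have "\<dots> = real (Suc n) * ?V + (real (Suc n) * ?E - c)\<^sup>2"
    by (simp add: algebra_simps)
  finally show ?case .
qed

section \<open>The estimator\<close>

lemma prob_space_gaussian_vector: "prob_space (gaussian_vector d)"
  unfolding gaussian_vector_def by (intro prob_space_PiM prob_space_std_normal)

lemma prob_space_table_law: "prob_space (table_law d t)"
  unfolding table_law_def by (intro prob_space_PiM prob_space_gaussian_vector)

lemma prob_space_tables_law: "prob_space (tables_law d t K)"
  unfolding tables_law_def by (intro prob_space_PiM prob_space_table_law)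

text \<open>As a real number the distance is a finite sum of measurable indicators, and the image of
  the finite set \<open>I\<close> in the reals is closed.\<close>

lemma pred_hamming_mem:
  assumes "I \<subseteq> {0..t}"
  shows "Measurable.pred (table_law d t) (\<lambda>r. hamming d t r u v \<in> I)"
proof -
  have fin: "finite I" using assms finite_subset by blast
  have real_hamming: "real (hamming d t r u v) = (\<Sum>j<t. if hash_bit d (r j) u \<noteq> hash_bit d (r j) v then 1 else 0)" for r
    unfolding hamming_def by (simp add: sum.If_cases Int_def)
  have [measurable]: "(\<lambda>r. r j) \<in> table_law d t \<rightarrow>\<^sub>M gaussian_vector d" if "j < t" for j
    unfolding table_law_def using that by auto
  have [measurable]: "(\<lambda>r. real (hamming d t r u v)) \<in> borel_measurable (table_law d t)"
    unfolding real_hamming by measurable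
  have "closed (real ` I)" using fin by (intro finite_imp_closed) auto
  then have "Measurable.pred (table_law d t) (\<lambda>r. real (hamming d t r u v) \<in> real ` I)"
    by (intro pred_sets2[OF _ \<open>_ \<in> borel_measurable _\<close>]) auto
  then show ?thesis by (simp add: image_iff)
qed

text \<open>Positivity of \<open>near_prob\<close> on the points sought gives the weights 1 / p(x)
  their meaning. A point with p(x) = 0 is almost never stored near \<open>q\<close>, so no weight
  could make up for it.\<close>

locale lsh_instance =
  fixes d :: nat and D :: "(nat \<Rightarrow> real) set" and q :: "nat \<Rightarrow> real" and A :: "real set"
    and t :: nat and I :: "nat set"
  assumes finite_D: "finite D" and D_unit: "D \<subseteq> unit_vectors d" and q_unit: "q \<in> unit_vectors d"
    and I_subset: "I \<subseteq> {0..t}"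
    and near_prob_pos: "\<And>x. x \<in> angle_set d D q A \<Longrightarrow> near_prob d t I q x > 0"
begin

abbreviation "p \<equiv> near_prob d t I q"

abbreviation "Aq \<equiv> angle_set d D q A"

abbreviation "pmin \<equiv> Min (p ` Aq)"

definition hit :: "(nat \<Rightarrow> real) \<Rightarrow> (nat \<Rightarrow> nat \<Rightarrow> real) \<Rightarrow> real" where
  "hit x r = of_bool (x \<in> bucket d D q t I r)"

definition bucket_size :: "(nat \<Rightarrow> nat \<Rightarrow> real) \<Rightarrow> real" where
  "bucket_size r = real (card (bucket d D q t I r))"

text \<open>Inverse probability weighting (Horvitz-Thompson): exponent 1 describes the conditional
  mean of a sample, exponent 2 its second moment.\<close>

definition weighted_hits :: "nat \<Rightarrow> (nat \<Rightarrow> nat \<Rightarrow> real) \<Rightarrow> real" where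
  "weighted_hits i r = (\<Sum>x\<in>Aq. hit x r / p x ^ i)"

lemma finite_Aq [simp]: "finite Aq"
  using finite_D by (auto simp: angle_set_def)

lemma Aq_subset: "Aq \<subseteq> D"
  by (auto simp: angle_set_def)

lemma hit_nonneg: "0 \<le> hit x r" and hit_le_1: "hit x r \<le> 1"
  by (auto simp: hit_def)

lemma pred_bucket [measurable]: "Measurable.pred (table_law d t) (\<lambda>r. x \<in> bucket d D q t I r)"
  unfolding bucket_def using pred_hamming_mem[OF I_subset, of d q x] by simp

lemma hit_measurable [measurable]: "hit x \<in> borel_measurable (table_law d t)"
  unfolding hit_def[abs_def] by measurable

lemma bucket_size_eq: "bucket_size r = (\<Sum>x\<in>D. hit x r)"
  using finite_D by (simp add: bucket_size_def bucket_def hit_def sum.If_cases Int_def of_bool_def)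

lemma bucket_size_nonneg: "0 \<le> bucket_size r"
  by (simp add: bucket_size_def)

lemma bucket_size_le: "bucket_size r \<le> real (card D)"
  unfolding bucket_size_eq using sum_mono[of D "\<lambda>x. hit x r" "\<lambda>_. 1"] hit_le_1 by simp

lemma bucket_size_measurable [measurable]: "bucket_size \<in> borel_measurable (table_law d t)"
  unfolding bucket_size_eq[abs_def] by measurable

lemma weighted_hits_measurable [measurable]: "weighted_hits i \<in> borel_measurable (table_law d t)"
  unfolding weighted_hits_def[abs_def] by measurable

lemma integrable_hit: "integrable (table_law d t) (hit x)"
proof -
  interpret prob_space "table_law d t" by (rule prob_space_table_law)
  show ?thesis using hit_nonneg hit_le_1 by (intro integrable_const_bound[where B = 1]) auto
qed

lemma integral_hit:
  assumes "x \<in> D"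
  shows "(\<integral>r. hit x r \<partial>table_law d t) = p x"
proof -
  interpret G: prob_space "gaussian_vector d" by (rule prob_space_gaussian_vector)
  have x: "x \<in> unit_vectors d" using assms D_unit by auto
  let ?E = "\<lambda>r. hash_bit d r q \<noteq> hash_bit d r x"
  \<comment> \<open>Cauchy-Schwarz keeps the argument of \<open>arccos\<close> in its domain. The
    angle is then nonnegative, and the \<open>ennreal\<close> probability can be read as a real
    number.\<close>
  have "norm (dotp d q x) \<le> 1"
  proof -
    have "\<bar>dotp d q x\<bar> \<le> (\<Sum>i<d. \<bar>q i\<bar> * \<bar>x i\<bar>)"
      unfolding dotp_def by (rule order_trans[OF sum_abs]) (simp add: abs_mult)
    also have "\<dots> \<le> L2_set q {..<d} * L2_set x {..<d}" by (rule L2_set_mult_ineq)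
    finally show ?thesis using q_unit x by (simp add: unit_vectors_def)
  qed
  then have "0 \<le> angle d q x" by (simp add: angle_def arccos_lbound abs_le_iff)
  then have pr: "angle d q x / pi = measure (gaussian_vector d) {r \<in> space (gaussian_vector d). ?E r}"
    using prob_hash_bit_neq[OF q_unit x] by (simp add: measure_def)
  have "(\<integral>r. hit x r \<partial>table_law d t)
    = (\<integral>r. indicator {r \<in> space (table_law d t). x \<in> bucket d D q t I r} r \<partial>table_law d t)"
    by (intro Bochner_Integration.integral_cong refl) (auto simp: hit_def)
  also have "\<dots> = measure (table_law d t) {r \<in> space (table_law d t). x \<in> bucket d D q t I r}"
    by simp
  also have "\<dots> = measure (table_law d t) {r \<in> space (table_law d t). card {j \<in> {..<t}. ?E (r j)} \<in> I}"
    using assms by (simp add: bucket_def hamming_def)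
  also have "\<dots> = p x"
    unfolding table_law_def near_prob_def
    by (rule prob_card_hits[OF prob_space_gaussian_vector _ pr I_subset]) measurable
  finally show ?thesis .
qed

text \<open>Read off the meaning of the binomial sum as the expectation of
  \<open>hit\<close>.\<close>

lemma p_le_1:
  assumes "x \<in> D"
  shows "p x \<le> 1"
proof -
  interpret prob_space "table_law d t" by (rule prob_space_table_law)
  have "(\<integral>r. hit x r \<partial>table_law d t) \<le> (\<integral>r. 1 \<partial>table_law d t)"
    by (intro integral_mono integrable_hit hit_le_1) auto
  then show ?thesis using integral_hit[OF assms] by (simp add: prob_space)
qed

lemma p_nonneg:
  assumes "x \<in> D"
  shows "0 \<le> p x"
  using Bochner_Integration.integral_nonneg[of "table_law d t" "hit x"] hit_nonneg integral_hit[OF assms] by simp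

lemma pmin_le: "x \<in> Aq \<Longrightarrow> pmin \<le> p x"
  by simp

lemma pmin_pos: "Aq \<noteq> {} \<Longrightarrow> 0 < pmin"
  using near_prob_pos by simp

lemma pmin_le_1: "Aq \<noteq> {} \<Longrightarrow> pmin \<le> 1"
  using pmin_le p_le_1 Aq_subset by (meson all_not_in_conv order_trans subsetD)

lemma weighted_hits_nonneg: "0 \<le> weighted_hits i r"
  unfolding weighted_hits_def
  using near_prob_pos by (intro sum_nonneg divide_nonneg_nonneg hit_nonneg zero_le_power less_imp_le) auto

lemma weighted_hits_le:
  assumes "Aq \<noteq> {}"
  shows "weighted_hits i r \<le> real (card Aq) / pmin ^ i"
proof -
  have "weighted_hits i r \<le> (\<Sum>x\<in>Aq. 1 / pmin ^ i)"
    unfolding weighted_hits_def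
  proof (rule sum_mono)
    fix x assume x: "x \<in> Aq"
    show "hit x r / p x ^ i \<le> 1 / pmin ^ i"
      using pmin_pos[OF assms] pmin_le[OF x]
      by (intro frac_le hit_le_1 power_mono zero_less_power) auto
  qed
  then show ?thesis by simp
qed

lemma expected_count_eq: "expected_count d D q t I = (\<integral>r. bucket_size r \<partial>table_law d t)"
  by (simp add: expected_count_def bucket_size_def)

lemma expected_count_eq_sum: "expected_count d D q t I = (\<Sum>x\<in>D. p x)"
  unfolding expected_count_eq bucket_size_eq
  by (simp add: integrable_hit integral_hit)

text \<open>Makes the claimed sample count at least 1, so that rounding it up to an integer costs
  only a constant factor.\<close>

lemma expected_count_ge: "real (card Aq) * pmin \<le> expected_count d D q t I"
proof -
  have "real (card Aq) * pmin = (\<Sum>x\<in>Aq. pmin)" by simp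
  also have "\<dots> \<le> (\<Sum>x\<in>Aq. p x)" by (intro sum_mono pmin_le)
  also have "\<dots> \<le> (\<Sum>x\<in>D. p x)" using finite_D Aq_subset p_nonneg by (intro sum_mono2) auto
  finally show ?thesis by (simp add: expected_count_eq_sum)
qed

text \<open>The expectation of \<open>hit x\<close> cancels one factor \<open>p x\<close>. The case
  i = 0 is unbiasedness; i = 1 serves the second moment.\<close>

lemma integral_weighted_hits:
  "(\<integral>r. weighted_hits (Suc i) r \<partial>table_law d t) = (\<Sum>x\<in>Aq. 1 / p x ^ i)"
proof -
  have "(\<integral>r. weighted_hits (Suc i) r \<partial>table_law d t) = (\<Sum>x\<in>Aq. p x / p x ^ Suc i)"
    unfolding weighted_hits_def using Aq_subset
    by (simp add: integrable_hit integral_hit subset_eq)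
  also have "\<dots> = (\<Sum>x\<in>Aq. 1 / p x ^ i)"
    using near_prob_pos by (intro sum.cong refl) (simp add: less_imp_neq[THEN not_sym])
  finally show ?thesis .
qed

section \<open>One copy of the estimator, given its tables\<close>

definition cond_mean :: "nat \<Rightarrow> (nat \<Rightarrow> nat \<Rightarrow> nat \<Rightarrow> real) \<Rightarrow> real" where
  "cond_mean K R = (\<Sum>k<K. weighted_hits 1 (R k)) / real K"

definition cond_second_moment :: "nat \<Rightarrow> (nat \<Rightarrow> nat \<Rightarrow> nat \<Rightarrow> real) \<Rightarrow> real" where
  "cond_second_moment K R = (\<Sum>k<K. bucket_size (R k)) * (\<Sum>k<K. weighted_hits 2 (R k)) / (real K)\<^sup>2"

lemma finite_bucket: "finite (bucket d D q t I r)"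
  using finite_D by (simp add: bucket_def)

lemma size_stored: "real (size (stored d D q t I K R)) = (\<Sum>k<K. bucket_size (R k))"
  by (simp add: stored_def bucket_size_def)

lemma count_stored: "real (count (stored d D q t I K R) x) = (\<Sum>k<K. hit x (R k))"
  by (simp add: stored_def hit_def count_sum count_mset_set' finite_bucket of_bool_def if_distrib cong: if_cong)

lemma set_stored: "set_mset (stored d D q t I K R) \<subseteq> D"
proof
  fix x assume "x \<in># stored d D q t I K R"
  then have "real (count (stored d D q t I K R) x) \<noteq> 0" by simp
  then show "x \<in> D" unfolding count_stored by (rule contrapos_np) (simp add: hit_def bucket_def)
qed

lemma sum_weighted_hits:
  "(\<Sum>k<K. weighted_hits i (R k)) = (\<Sum>x\<in>Aq. real (count (stored d D q t I K R) x) / p x ^ i)"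
  unfolding weighted_hits_def count_stored by (subst sum.swap) (simp add: sum_divide_distrib)

text \<open>A point is drawn with probability count / size and then contributes size / (K * p(x)).
  The random size cancels in the mean, while one factor of it survives in the second moment.\<close>

lemma cond_moments:
  assumes "stored d D q t I K R \<noteq> {#}" and K: "K > 0"
  defines "\<mu> \<equiv> pmf_of_multiset (stored d D q t I K R)"
  shows "measure_pmf.expectation \<mu> (Z_value d D q A t I K R) = cond_mean K R"
    and "measure_pmf.expectation \<mu> (\<lambda>x. (Z_value d D q A t I K R x)\<^sup>2) = cond_second_moment K R"
proof -
  let ?M = "stored d D q t I K R" and ?Z = "Z_value d D q A t I K R"
  have size: "real (size ?M) > 0" using assms(1) by (simp add: nonempty_has_size[symmetric])
  have pmf: "pmf \<mu> x = real (count ?M x) / real (size ?M)" for x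
    using assms(1) by (simp add: \<mu>_def)
  have supp: "x \<in> Aq" if "x \<in> set_pmf \<mu>" "?Z x \<noteq> 0" for x
    using that set_stored[of K R] assms(1) by (auto simp: \<mu>_def Z_value_def angle_set_def split: if_splits)
  have Z: "?Z x = real (size ?M) / (real K * p x)" if "x \<in> Aq" for x
    using that by (simp add: Z_value_def angle_set_def size_stored bucket_size_def)
  have "measure_pmf.expectation \<mu> ?Z = (\<Sum>x\<in>Aq. ?Z x * pmf \<mu> x)"
    by (rule integral_measure_pmf_real) (auto intro: supp)
  also have "\<dots> = (\<Sum>x\<in>Aq. real (count ?M x) / p x ^ 1 / real K)"
    using size by (intro sum.cong refl) (simp add: Z pmf)
  also have "\<dots> = cond_mean K R"
    unfolding cond_mean_def sum_weighted_hits by (simp add: sum_divide_distrib)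
  finally show "measure_pmf.expectation \<mu> ?Z = cond_mean K R" .
  have "measure_pmf.expectation \<mu> (\<lambda>x. (?Z x)\<^sup>2) = (\<Sum>x\<in>Aq. (?Z x)\<^sup>2 * pmf \<mu> x)"
    by (rule integral_measure_pmf_real) (auto intro: supp)
  also have "\<dots> = (\<Sum>x\<in>Aq. real (size ?M) * (real (count ?M x) / p x ^ 2) / (real K)\<^sup>2)"
    using size by (intro sum.cong refl) (simp add: Z pmf power2_eq_square)
  also have "\<dots> = cond_second_moment K R"
    unfolding cond_second_moment_def sum_weighted_hits size_stored[symmetric]
    by (simp add: sum_divide_distrib sum_distrib_left)
  finally show "measure_pmf.expectation \<mu> (\<lambda>x. (?Z x)\<^sup>2) = cond_second_moment K R" .
qed

lemma cond_second_moment_nonneg: "0 \<le> cond_second_moment K R"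
  unfolding cond_second_moment_def
  by (intro divide_nonneg_nonneg mult_nonneg_nonneg sum_nonneg bucket_size_nonneg weighted_hits_nonneg) auto

definition sample_mean :: "nat \<Rightarrow> nat \<Rightarrow> (nat \<Rightarrow> nat \<Rightarrow> nat \<Rightarrow> real) \<Rightarrow> (nat \<Rightarrow> real) list \<Rightarrow> real" where
  "sample_mean K S R xs = (\<Sum>x\<leftarrow>xs. Z_value d D q A t I K R x) / real S"

definition samples :: "nat \<Rightarrow> nat \<Rightarrow> (nat \<Rightarrow> nat \<Rightarrow> nat \<Rightarrow> real) \<Rightarrow> (nat \<Rightarrow> real) list pmf" where
  "samples K S R = replicate_pmf S (pmf_of_multiset (stored d D q t I K R))"

text \<open>Given the tables the samples are independent, so the error splits into variance / S plus
  squared bias; the variance is relaxed to the second moment.\<close>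

lemma nn_integral_sample_mean:
  assumes K: "K > 0" and S: "S > 0"
  shows "(\<integral>\<^sup>+xs. ennreal ((sample_mean K S R xs - c)\<^sup>2) \<partial>samples K S R)
    \<le> ennreal (cond_second_moment K R / real S + (cond_mean K R - c)\<^sup>2)"
proof (cases "stored d D q t I K R = {#}")
  \<comment> \<open>The law being sampled is unspecified here, but every value of Z and the
    conditional mean are 0, so both squared deviations equal c^2.\<close>
  case True
  then have "(\<Sum>k<K. bucket_size (R k)) = 0" using size_stored[of K R] by simp
  then have Z: "Z_value d D q A t I K R x = 0" for x by (simp add: Z_value_def bucket_size_def)
  have "sample_mean K S R xs = 0" for xs by (simp add: sample_mean_def Z)
  moreover have "cond_mean K R = 0" using True by (simp add: cond_mean_def sum_weighted_hits)
  ultimately show ?thesis using cond_second_moment_nonneg[of K R]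
    by (simp add: measure_pmf.emeasure_space_1[simplified])
next
  case False
  let ?p = "pmf_of_multiset (stored d D q t I K R)" and ?Z = "Z_value d D q A t I K R"
  have fin: "finite (set_pmf ?p)" using False by simp
  have int: "integrable (measure_pmf ?p) g" for g :: "_ \<Rightarrow> real"
    by (rule integrable_measure_pmf_finite[OF fin])
  have var: "measure_pmf.variance ?p ?Z \<le> cond_second_moment K R"
    using measure_pmf.variance_eq[of ?p ?Z] int cond_moments[OF False K] by simp
  have "(sample_mean K S R xs - c)\<^sup>2 = (1 / (real S)\<^sup>2) * ((\<Sum>x\<leftarrow>xs. ?Z x) - real S * c)\<^sup>2" for xs
  proof -
    have "sample_mean K S R xs - c = ((\<Sum>x\<leftarrow>xs. ?Z x) - real S * c) / real S"
      using S by (simp add: sample_mean_def field_simps)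
    then show ?thesis by (simp add: power_divide)
  qed
  then have "(\<integral>\<^sup>+xs. ennreal ((sample_mean K S R xs - c)\<^sup>2) \<partial>samples K S R)
    = (\<integral>\<^sup>+xs. ennreal (1 / (real S)\<^sup>2) * ennreal (((\<Sum>x\<leftarrow>xs. ?Z x) - real S * c)\<^sup>2) \<partial>samples K S R)"
    by (simp add: ennreal_mult[symmetric] del: ennreal_mult_eq_top_iff)
  also have "\<dots> = ennreal (1 / (real S)\<^sup>2) *
      ennreal (real S * measure_pmf.variance ?p ?Z + (real S * cond_mean K R - real S * c)\<^sup>2)"
    unfolding samples_def
    by (simp add: nn_integral_cmult nn_integral_replicate_pmf_square[OF fin] cond_moments(1)[OF False K])
  also have "\<dots> = ennreal (measure_pmf.variance ?p ?Z / real S + (cond_mean K R - c)\<^sup>2)"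
  proof -
    have "(1 / (real S)\<^sup>2) * (real S * v + (real S * a - real S * c)\<^sup>2) = v / real S + (a - c)\<^sup>2" for v a
    proof -
      have "real S * a - real S * c = real S * (a - c)" by (simp add: algebra_simps)
      then show ?thesis using S by (simp add: power_mult_distrib distrib_left power2_eq_square)
    qed
    then show ?thesis by (subst ennreal_mult'[symmetric]) simp_all
  qed
  also have "\<dots> \<le> ennreal (cond_second_moment K R / real S + (cond_mean K R - c)\<^sup>2)"
    using var by (intro ennreal_leI add_right_mono divide_right_mono) auto
  finally show ?thesis .
qed

section \<open>The unconditional law of one copy\<close>

lemma mean_law_eq:
  "mean_law d D q A t I K S = tables_law d t K \<bind> (\<lambda>R. distr (samples K S R) borel (sample_mean K S R))"
  unfolding mean_law_def samples_def sample_mean_def[abs_def] ..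

text \<open>
  The conditional law depends on the tables only through the buckets, a map with finite range.
\<close>

lemma sample_law_measurable:
  "(\<lambda>R. distr (samples K S R) borel (sample_mean K S R)) \<in> tables_law d t K \<rightarrow>\<^sub>M prob_algebra borel"
proof -
  define \<Omega> where "\<Omega> = (\<Pi>\<^sub>E k\<in>{..<K}. Pow D)"
  \<comment> \<open>The bucket pattern of all tables. Restricting it to the table indices puts it
    into the finite set \<open>\<Omega>\<close>.\<close>
  define \<beta> where "\<beta> R = (\<lambda>k\<in>{..<K}. bucket d D q t I (R k))" for R
  \<comment> \<open>The conditional law as a function of the pattern alone: on a discrete space it
    is measurable for free.\<close>
  define G where "G b = distr (measure_pmf (replicate_pmf S (pmf_of_multiset (\<Sum>k<K. mset_set (b k))))) borel
    (\<lambda>xs. (\<Sum>x\<leftarrow>xs. if angle d q x \<in> A then (\<Sum>k<K. real (card (b k))) / (real K * p x) else 0) / real S)"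
    for b :: "nat \<Rightarrow> (nat \<Rightarrow> real) set"
  have fin: "finite \<Omega>" unfolding \<Omega>_def using finite_D by (intro finite_PiE) auto
  have comp[measurable]: "(\<lambda>R. R k) \<in> tables_law d t K \<rightarrow>\<^sub>M table_law d t" if "k < K" for k
    unfolding tables_law_def using that by auto
  have \<beta>: "\<beta> \<in> tables_law d t K \<rightarrow>\<^sub>M count_space \<Omega>"
    unfolding measurable_count_space_eq2[OF fin]
  proof (intro conjI ballI)
    show "\<beta> \<in> space (tables_law d t K) \<rightarrow> \<Omega>" by (auto simp: \<beta>_def \<Omega>_def bucket_def)
    fix b assume b: "b \<in> \<Omega>"
    have eq: "\<beta> R = b \<longleftrightarrow> (\<forall>k\<in>{..<K}. \<forall>x\<in>D. x \<in> bucket d D q t I (R k) \<longleftrightarrow> x \<in> b k)" for R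
    proof -
      have "\<beta> R = b \<longleftrightarrow> (\<forall>k\<in>{..<K}. \<beta> R k = b k)"
        using b by (intro iffI ballI PiE_ext[of _ "{..<K}" "\<lambda>_. Pow D"])
                   (auto simp: \<beta>_def \<Omega>_def bucket_def)
      also have "\<dots> \<longleftrightarrow> (\<forall>k\<in>{..<K}. \<forall>x\<in>D. x \<in> bucket d D q t I (R k) \<longleftrightarrow> x \<in> b k)"
        using b by (intro ball_cong refl) (fastforce simp: \<beta>_def \<Omega>_def bucket_def PiE_iff)
      finally show ?thesis .
    qed
    have "\<beta> -` {b} \<inter> space (tables_law d t K) = {R \<in> space (tables_law d t K).
        \<forall>k\<in>{..<K}. \<forall>x\<in>D. x \<in> bucket d D q t I (R k) \<longleftrightarrow> x \<in> b k}"
      using eq by auto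
    also have "\<dots> \<in> sets (tables_law d t K)"
      using finite_D by measurable
    finally show "\<beta> -` {b} \<inter> space (tables_law d t K) \<in> sets (tables_law d t K)" .
  qed
  have G: "G \<in> count_space \<Omega> \<rightarrow>\<^sub>M prob_algebra borel"
    by (auto simp: G_def space_prob_algebra intro!: measure_pmf.prob_space_distr)
  have "distr (samples K S R) borel (sample_mean K S R) = G (\<beta> R)" for R
  proof -
    have "(\<Sum>k<K. mset_set (\<beta> R k)) = stored d D q t I K R"
      unfolding stored_def by (intro sum.cong) (auto simp: \<beta>_def)
    moreover have "(\<Sum>k<K. real (card (\<beta> R k))) = (\<Sum>k<K. real (card (bucket d D q t I (R k))))"
      by (intro sum.cong) (auto simp: \<beta>_def)
    ultimately show ?thesis
      by (simp add: G_def samples_def sample_mean_def[abs_def] Z_value_def[abs_def] cong: if_cong)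
  qed
  then show ?thesis using measurable_compose[OF \<beta> G] by simp
qed

lemma prob_space_mean_law: "prob_space (mean_law d D q A t I K S)"
  and sets_mean_law: "sets (mean_law d D q A t I K S) = sets borel"
proof -
  have T: "tables_law d t K \<in> space (prob_algebra (tables_law d t K))"
    by (simp add: space_prob_algebra prob_space_tables_law)
  show "prob_space (mean_law d D q A t I K S)"
    unfolding mean_law_eq by (rule prob_space_bind'[OF T sample_law_measurable])
  show "sets (mean_law d D q A t I K S) = sets borel"
    unfolding mean_law_eq by (rule sets_bind'[OF T sample_law_measurable])
qed

lemma emeasure_mean_law:
  assumes [measurable]: "X \<in> sets borel"
  shows "emeasure (mean_law d D q A t I K S) X
    = (\<integral>\<^sup>+R. \<integral>\<^sup>+xs. indicator X (sample_mean K S R xs) \<partial>samples K S R \<partial>tables_law d t K)"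
proof -
  interpret prob_space "tables_law d t K" by (rule prob_space_tables_law)
  have "emeasure (mean_law d D q A t I K S) X
    = (\<integral>\<^sup>+R. emeasure (distr (samples K S R) borel (sample_mean K S R)) X \<partial>tables_law d t K)"
    unfolding mean_law_eq
    by (rule emeasure_bind[OF not_empty measurable_prob_algebraD[OF sample_law_measurable] assms])
  also have "\<dots> = (\<integral>\<^sup>+R. \<integral>\<^sup>+xs. indicator X (sample_mean K S R xs) \<partial>samples K S R \<partial>tables_law d t K)"
    by (intro nn_integral_cong) (simp add: nn_integral_indicator[symmetric] nn_integral_distr del: nn_integral_indicator)
  finally show ?thesis .
qed

text \<open>The target interval shrinks to a point, out of reach of Chebyshev's inequality; but then
  both conditional moments vanish, so the estimate is almost surely 0.\<close>

lemma mean_law_empty: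
  assumes "Aq = {}" "K > 0" "S > 0"
  shows "measure (mean_law d D q A t I K S) (- {0..0}) = 0"
proof -
  have "(\<integral>\<^sup>+xs. indicator (- {0..0}) (sample_mean K S R xs) \<partial>samples K S R) = (0::ennreal)" for R
  proof -
    have "cond_mean K R = 0" "cond_second_moment K R = 0"
      using assms by (simp_all add: cond_mean_def cond_second_moment_def weighted_hits_def)
    then have "(\<integral>\<^sup>+xs. ennreal ((sample_mean K S R xs - 0)\<^sup>2) \<partial>samples K S R) = 0"
      using nn_integral_sample_mean[OF assms(2,3), of R 0] by simp
    then have "AE xs in samples K S R. sample_mean K S R xs = 0"
      by (subst (asm) nn_integral_0_iff_AE) (auto simp: ennreal_eq_0_iff elim!: eventually_mono)
    then have "AE xs in samples K S R. indicator (- {0..0}) (sample_mean K S R xs) = (0::ennreal)"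
      by eventually_elim simp
    then show ?thesis by (subst nn_integral_0_iff_AE) auto
  qed
  then show ?thesis by (simp add: measure_def emeasure_mean_law)
qed

text \<open>The first summand is the sampling error given the tables, the second the fluctuation of
  the conditional mean between tables. The correction 1 / (K * pmin) stems from bucket size and
  weighted hits in the same table.\<close>

lemma mean_law_concentration:
  assumes ne: "Aq \<noteq> {}" and K: "K > 0" and S: "S > 0" and \<rho>: "\<rho> > 0"
  defines "n \<equiv> real (card Aq)"
  shows "measure (mean_law d D q A t I K S) (- {n - \<rho>..n + \<rho>})
    \<le> (expected_count d D q t I * n / pmin * (1 + 1 / (real K * pmin)) / real S + n\<^sup>2 / (real K * pmin)) / \<rho>\<^sup>2"
proof -
  let ?T = "table_law d t" and ?P = "tables_law d t K"
  interpret T: prob_space ?T by (rule prob_space_table_law)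
  interpret P: prob_space ?P by (rule prob_space_tables_law)
  interpret L: prob_space "mean_law d D q A t I K S" by (rule prob_space_mean_law)
  define EC where "EC = expected_count d D q t I"
  have pm: "0 < pmin" by (rule pmin_pos[OF ne])
  have n: "n \<ge> 0" by (simp add: n_def)
  have EC: "0 \<le> EC" unfolding EC_def expected_count_eq by (intro integral_nonneg_AE) (auto simp: bucket_size_nonneg)
  \<comment> \<open>One common bound, since the moment lemmas expect the same \<open>B\<close> for
    both functions.\<close>
  define B where "B = max (real (card D)) (max (n / pmin) (n / pmin\<^sup>2))"
  have w1: "\<bar>weighted_hits 1 r\<bar> \<le> B" and w2: "\<bar>weighted_hits 2 r\<bar> \<le> B" and bs: "\<bar>bucket_size r\<bar> \<le> B" for r
    using weighted_hits_le[OF ne, of 1 r] weighted_hits_le[OF ne, of 2 r] bucket_size_le[of r]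
      weighted_hits_nonneg[of 1 r] weighted_hits_nonneg[of 2 r] bucket_size_nonneg[of r]
    by (auto simp: B_def n_def)
  have int_w1: "integrable ?T (weighted_hits 1)" and int_bs: "integrable ?T bucket_size"
    using w1 w2 bs by (auto intro!: T.integrable_const_bound[where B = B])
  have int_w11: "integrable ?T (\<lambda>r. weighted_hits 1 r * weighted_hits 1 r)"
    and int_b2: "integrable ?T (\<lambda>r. bucket_size r * weighted_hits 2 r)"
  proof -
    have "norm (x * y) \<le> B * B" if "\<bar>x\<bar> \<le> B" "\<bar>y\<bar> \<le> B" for x y :: real
      using mult_mono[OF that order_trans[OF abs_ge_zero that(1)]] by (simp add: abs_mult)
    note bound = this[OF w1 w1] this[OF bs w2]
    show "integrable ?T (\<lambda>r. weighted_hits 1 r * weighted_hits 1 r)"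
      "integrable ?T (\<lambda>r. bucket_size r * weighted_hits 2 r)"
      by (rule T.integrable_const_bound[OF AE_I2[OF bound(1)]], measurable)
         (rule T.integrable_const_bound[OF AE_I2[OF bound(2)]], measurable)
  qed
  have E1: "(\<integral>r. weighted_hits 1 r \<partial>?T) = n"
    using integral_weighted_hits[of 0] by (simp add: n_def)
  have E2: "(\<integral>r. weighted_hits 2 r \<partial>?T) \<le> n / pmin"
  proof -
    have "(\<integral>r. weighted_hits 2 r \<partial>?T) = (\<Sum>x\<in>Aq. 1 / p x)"
      using integral_weighted_hits[of 1] by (simp add: numeral_2_eq_2)
    also have "\<dots> \<le> (\<Sum>x\<in>Aq. 1 / pmin)"
      using pm pmin_le near_prob_pos by (intro sum_mono divide_left_mono mult_pos_pos) auto
    finally show ?thesis by (simp add: n_def)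
  qed
  \<comment> \<open>Bounding one of the two factors pointwise avoids the joint hit probabilities of
    two points; \<open>Eb2\<close> proceeds alike.\<close>
  have E11: "(\<integral>r. weighted_hits 1 r * weighted_hits 1 r \<partial>?T) \<le> n\<^sup>2 / pmin"
  proof -
    have "(\<integral>r. weighted_hits 1 r * weighted_hits 1 r \<partial>?T) \<le> (\<integral>r. n / pmin * weighted_hits 1 r \<partial>?T)"
      using weighted_hits_le[OF ne, of 1] weighted_hits_nonneg
      by (intro integral_mono int_w11 integrable_mult_right int_w1 mult_right_mono) (auto simp: n_def)
    then show ?thesis using E1 by (simp add: power2_eq_square)
  qed
  have Eb2: "(\<integral>r. bucket_size r * weighted_hits 2 r \<partial>?T) \<le> EC * (n / pmin\<^sup>2)"
  proof -
    have "(\<integral>r. bucket_size r * weighted_hits 2 r \<partial>?T) \<le> (\<integral>r. bucket_size r * (n / pmin\<^sup>2) \<partial>?T)"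
      using weighted_hits_le[OF ne, of 2] bucket_size_nonneg
      by (intro integral_mono int_b2 integrable_mult_left int_bs mult_left_mono) (auto simp: n_def)
    then show ?thesis by (simp add: EC_def expected_count_eq)
  qed
  have cm2: "(cond_mean K R - n)\<^sup>2 = (\<Sum>k<K. weighted_hits 1 (R k)) * (\<Sum>k<K. weighted_hits 1 (R k)) / (real K)\<^sup>2
      - 2 * n / real K * (\<Sum>k<K. weighted_hits 1 (R k)) + n\<^sup>2" for R
    by (simp add: cond_mean_def power2_diff power_divide) (simp add: power2_eq_square)
  note int_11 = integrable_PiM_sum_mult[OF T.prob_space_axioms weighted_hits_measurable weighted_hits_measurable w1 w1,
      of K, folded tables_law_def]
  note int_B2 = integrable_PiM_sum_mult[OF T.prob_space_axioms bucket_size_measurable weighted_hits_measurable bs w2,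
      of K, folded tables_law_def]
  note I_11 = integral_PiM_sum_mult[OF T.prob_space_axioms weighted_hits_measurable weighted_hits_measurable w1 w1,
      of K, folded tables_law_def]
  note I_B2 = integral_PiM_sum_mult[OF T.prob_space_axioms bucket_size_measurable weighted_hits_measurable bs w2,
      of K, folded tables_law_def]
  note I_1 = integral_PiM_sum[OF T.prob_space_axioms int_w1, of K, folded tables_law_def]
  have int_1: "integrable ?P (\<lambda>R. \<Sum>k<K. weighted_hits 1 (R k))"
  proof (rule P.integrable_const_bound[where B = "real K * B"])
    have "\<bar>\<Sum>k<K. weighted_hits 1 (R k)\<bar> \<le> (\<Sum>k<K. B)" for R
      using w1 by (intro order_trans[OF sum_abs] sum_mono) auto
    then show "AE R in ?P. norm (\<Sum>k<K. weighted_hits 1 (R k)) \<le> real K * B" by simp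
    have [measurable]: "(\<lambda>R. R k) \<in> ?P \<rightarrow>\<^sub>M ?T" if "k < K" for k
      unfolding tables_law_def using that by auto
    show "(\<lambda>R. \<Sum>k<K. weighted_hits 1 (R k)) \<in> borel_measurable ?P" by measurable
  qed
  have int_var: "integrable ?P (\<lambda>R. (cond_mean K R - n)\<^sup>2)"
    unfolding cm2 using int_11 int_1 by simp
  have int_csm: "integrable ?P (cond_second_moment K)"
    unfolding cond_second_moment_def[abs_def] using int_B2 by simp
  have var: "(\<integral>R. (cond_mean K R - n)\<^sup>2 \<partial>?P) \<le> n\<^sup>2 / (real K * pmin)"
  proof -
    define w where "w = (\<integral>r. weighted_hits 1 r * weighted_hits 1 r \<partial>?T)"
    have "(\<integral>R. (cond_mean K R - n)\<^sup>2 \<partial>?P) =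
      (real K * w + real K * (real K - 1) * (n * n)) / (real K)\<^sup>2 - 2 * n / real K * (real K * n) + n\<^sup>2"
      unfolding cm2 using int_11 int_1 by (simp add: I_11 I_1 E1 w_def P.prob_space del: One_nat_def)
    also have "\<dots> = w / real K - n\<^sup>2 / real K"
      using K by (simp add: field_simps power2_eq_square)
    also have "\<dots> \<le> w / real K" by simp
    also have "\<dots> \<le> (n\<^sup>2 / pmin) / real K" using E11 by (intro divide_right_mono) (auto simp: w_def)
    finally show ?thesis by (simp add: mult.commute)
  qed
  have csm: "(\<integral>R. cond_second_moment K R \<partial>?P) \<le> EC * n / pmin * (1 + 1 / (real K * pmin))"
  proof -
    have "(\<integral>R. cond_second_moment K R \<partial>?P) = (real K * (\<integral>r. bucket_size r * weighted_hits 2 r \<partial>?T)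
        + real K * (real K - 1) * (EC * (\<integral>r. weighted_hits 2 r \<partial>?T))) / (real K)\<^sup>2"
      unfolding cond_second_moment_def by (simp add: I_B2 EC_def expected_count_eq)
    \<comment> \<open>The diagonal terms become the correction 1 / (K * pmin); the off-diagonal
      ones, with K - 1 relaxed to K, become the 1.\<close>
    also have "\<dots> \<le> (real K * (EC * (n / pmin\<^sup>2)) + real K * real K * (EC * (n / pmin))) / (real K)\<^sup>2"
      using EC K n pm weighted_hits_nonneg
      by (intro divide_right_mono add_mono mult_left_mono[OF Eb2] mult_mono E2 mult_nonneg_nonneg
            integral_nonneg_AE) auto
    also have "\<dots> = EC * n / pmin * (1 + 1 / (real K * pmin))"
      using K pm by (simp add: field_simps power2_eq_square)
    finally show ?thesis .
  qed
  have "emeasure (mean_law d D q A t I K S) (- {n - \<rho>..n + \<rho>})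
    = (\<integral>\<^sup>+R. \<integral>\<^sup>+xs. indicator (- {n - \<rho>..n + \<rho>}) (sample_mean K S R xs) \<partial>samples K S R \<partial>?P)"
    by (rule emeasure_mean_law) auto
  \<comment> \<open>Chebyshev's inequality pointwise, inside both integrals, because the error bound
    for the samples is conditional on the tables.\<close>
  also have "\<dots> \<le> (\<integral>\<^sup>+R. \<integral>\<^sup>+xs. ennreal (1 / \<rho>\<^sup>2) * ennreal ((sample_mean K S R xs - n)\<^sup>2) \<partial>samples K S R \<partial>?P)"
  proof (intro nn_integral_mono)
    fix R xs
    show "indicator (- {n - \<rho>..n + \<rho>}) (sample_mean K S R xs)
      \<le> ennreal (1 / \<rho>\<^sup>2) * ennreal ((sample_mean K S R xs - n)\<^sup>2)"
    proof (cases "sample_mean K S R xs \<in> {n - \<rho>..n + \<rho>}")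
      case False
      then have "\<rho> \<le> \<bar>sample_mean K S R xs - n\<bar>" by auto
      then have "\<rho>\<^sup>2 \<le> (sample_mean K S R xs - n)\<^sup>2"
        using \<rho> abs_le_square_iff[of \<rho> "sample_mean K S R xs - n"] by simp
      then have "1 \<le> 1 / \<rho>\<^sup>2 * (sample_mean K S R xs - n)\<^sup>2" using \<rho> by (simp add: field_simps)
      then have "ennreal 1 \<le> ennreal (1 / \<rho>\<^sup>2 * (sample_mean K S R xs - n)\<^sup>2)" by (rule ennreal_leI)
      then have "ennreal 1 \<le> ennreal (1 / \<rho>\<^sup>2) * ennreal ((sample_mean K S R xs - n)\<^sup>2)"
        by (subst (asm) ennreal_mult) auto
      then show ?thesis using False by simp
    qed simp
  qed
  also have "\<dots> = (\<integral>\<^sup>+R. ennreal (1 / \<rho>\<^sup>2) *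
       (\<integral>\<^sup>+xs. ennreal ((sample_mean K S R xs - n)\<^sup>2) \<partial>samples K S R) \<partial>?P)"
    by (simp add: nn_integral_cmult)
  also have "\<dots> \<le> (\<integral>\<^sup>+R. ennreal (1 / \<rho>\<^sup>2) *
       ennreal (cond_second_moment K R / real S + (cond_mean K R - n)\<^sup>2) \<partial>?P)"
    by (intro nn_integral_mono mult_left_mono nn_integral_sample_mean K S) auto
  also have "\<dots> = (\<integral>\<^sup>+R. ennreal (1 / \<rho>\<^sup>2 * (cond_second_moment K R / real S + (cond_mean K R - n)\<^sup>2)) \<partial>?P)"
    using cond_second_moment_nonneg
    by (intro nn_integral_cong ennreal_mult[symmetric] add_nonneg_nonneg divide_nonneg_nonneg) auto
  also have "\<dots> = ennreal (\<integral>R. 1 / \<rho>\<^sup>2 * (cond_second_moment K R / real S + (cond_mean K R - n)\<^sup>2) \<partial>?P)"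
    using int_var int_csm cond_second_moment_nonneg
    by (intro nn_integral_eq_integral AE_I2 mult_nonneg_nonneg add_nonneg_nonneg divide_nonneg_nonneg) auto
  also have "(\<integral>R. 1 / \<rho>\<^sup>2 * (cond_second_moment K R / real S + (cond_mean K R - n)\<^sup>2) \<partial>?P)
    = ((\<integral>R. cond_second_moment K R \<partial>?P) / real S + (\<integral>R. (cond_mean K R - n)\<^sup>2 \<partial>?P)) / \<rho>\<^sup>2"
    using int_var int_csm by simp
  finally have "measure (mean_law d D q A t I K S) (- {n - \<rho>..n + \<rho>})
    \<le> ((\<integral>R. cond_second_moment K R \<partial>?P) / real S + (\<integral>R. (cond_mean K R - n)\<^sup>2 \<partial>?P)) / \<rho>\<^sup>2"
    using cond_second_moment_nonneg unfolding L.emeasure_eq_measure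
    by (subst (asm) ennreal_le_iff)
       (auto intro!: divide_nonneg_nonneg add_nonneg_nonneg integral_nonneg_AE)
  also have "\<dots> \<le> (EC * n / pmin * (1 + 1 / (real K * pmin)) / real S + n\<^sup>2 / (real K * pmin)) / \<rho>\<^sup>2"
    by (intro divide_right_mono add_mono csm var) auto
  finally show ?thesis unfolding EC_def .
qed

end

section \<open>The numbers of copies, tables and samples\<close>

lemma ceiling_le_mult:
  fixes c x :: real
  assumes "0 \<le> c" "1 \<le> x"
  shows "real (nat \<lceil>c * x\<rceil>) \<le> (c + 1) * x"
proof -
  have "0 \<le> c * x" using assms by simp
  then have "real (nat \<lceil>c * x\<rceil>) \<le> c * x + 1" by linarith
  then show ?thesis using assms by (simp add: algebra_simps)
qed

lemma ceiling_ge: "c * x \<le> real (nat \<lceil>c * x\<rceil>)" for c x :: real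
  by linarith

context lsh_instance
begin

text \<open>Relative to \<open>\<epsilon>\<^sup>2\<close> the tables contribute at most 1/8. The
  samples contribute 1/16, at most doubled by 1 + 1 / (K * pmin), hence also 1/8; the total is
  1/4.\<close>

lemma mean_law_accuracy:
  fixes \<epsilon> :: real
  assumes ne: "Aq \<noteq> {}" and \<epsilon>: "0 < \<epsilon>" "\<epsilon> < 1" and KS: "K > 0" "S > 0"
    and K: "8 * (1 / (\<epsilon>\<^sup>2 * pmin)) \<le> real K"
    and S: "16 * (expected_count d D q t I / (\<epsilon>\<^sup>2 * real (card Aq) * pmin)) \<le> real S"
  shows "measure (mean_law d D q A t I K S)
    (- {(1 - \<epsilon>) * real (card Aq)..(1 + \<epsilon>) * real (card Aq)}) \<le> 1 / 4"
proof -
  define n where "n = real (card Aq)"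
  define EC where "EC = expected_count d D q t I"
  have n: "n > 0" using ne by (simp add: n_def card_gt_0_iff)
  have pm: "0 < pmin" by (rule pmin_pos[OF ne])
  have EC: "EC > 0" using expected_count_ge n pm mult_pos_pos[of n pmin] unfolding EC_def n_def by linarith
  have e2: "\<epsilon>\<^sup>2 > 0" "\<epsilon>\<^sup>2 \<le> 1" using \<epsilon> by (auto intro: power_le_one)
  have Kp: "real K * pmin > 0" using KS pm by simp
  have K1: "1 / (real K * pmin) \<le> \<epsilon>\<^sup>2 / 8"
    using K e2 pm Kp by (simp add: field_simps)
  have S1: "EC / (n * pmin * real S) \<le> \<epsilon>\<^sup>2 / 16"
    using S e2 pm n KS unfolding EC_def[symmetric] n_def[symmetric] by (simp add: field_simps)
  have "measure (mean_law d D q A t I K S) (- {n - \<epsilon> * n..n + \<epsilon> * n})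
    \<le> (EC * n / pmin * (1 + 1 / (real K * pmin)) / real S + n\<^sup>2 / (real K * pmin)) / (\<epsilon> * n)\<^sup>2"
    unfolding EC_def n_def using n \<epsilon> by (intro mean_law_concentration ne KS) (simp add: n_def)
  also have "\<dots> = (EC / (n * pmin * real S) * (1 + 1 / (real K * pmin)) + 1 / (real K * pmin)) / \<epsilon>\<^sup>2"
  proof -
    have "(EC * n / pmin * u / real S + n\<^sup>2 * v) / (\<epsilon> * n)\<^sup>2 = (EC / (n * pmin * real S) * u + v) / \<epsilon>\<^sup>2" for u v
    proof -
      have "EC * n / pmin * u / real S = n\<^sup>2 * (EC / (n * pmin * real S) * u)"
        using n by (simp add: power2_eq_square)
      then have "EC * n / pmin * u / real S + n\<^sup>2 * v = n\<^sup>2 * (EC / (n * pmin * real S) * u + v)"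
        by (simp only: distrib_left)
      then show ?thesis using n by (simp only: power_mult_distrib) simp
    qed
    from this[of "1 + 1 / (real K * pmin)" "1 / (real K * pmin)"] show ?thesis by simp
  qed
  also have "\<dots> \<le> (\<epsilon>\<^sup>2 / 16 * (1 + 1) + \<epsilon>\<^sup>2 / 8) / \<epsilon>\<^sup>2"
  proof -
    have "1 / (real K * pmin) \<le> 1" using K1 e2 by linarith
    then show ?thesis
      using K1 S1 e2 Kp EC n pm by (intro divide_right_mono add_mono mult_mono) auto
  qed
  also have "\<dots> = 1 / 4" using e2 by (simp add: field_simps)
  finally show ?thesis by (simp add: n_def algebra_simps)
qed

text \<open>The factor 8 inverts the exponent m/8 of \<open>median_boosting\<close>.\<close>

lemma median_accuracy:
  fixes \<delta> :: real
  assumes fail: "measure (mean_law d D q A t I K S) (- {a..b}) \<le> 1 / 4"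
    and \<delta>: "0 < \<delta>" and m: "m > 0" "8 * max 1 (ln (1 / \<delta>)) \<le> real m"
  shows "1 - \<delta> \<le> measure (lsh_count_law d D q A t I m K S) {a..b}"
proof -
  have "- real m / 8 \<le> ln \<delta>" using m \<delta> by (simp add: ln_div)
  then have "exp (- real m / 8) \<le> \<delta>" using \<delta> by (metis exp_le_cancel_iff exp_ln)
  then show ?thesis
    using median_boosting[OF prob_space_mean_law sets_mean_law fail m(1)] unfolding lsh_count_law_def by linarith
qed

end

text \<open>The constants precede all data, the dimension included. The logarithm is capped below by
  1, since it tends to 0 as \<delta> approaches 1 while at least one table and one sample are used.
  The cost bounds presuppose a nonempty set of points sought, over which the minimum is taken; where
  that minimum is 0 the informal bounds are infinite, whereas division by zero in HOL would make
  them 0.\<close>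

theorem theorem1:
  shows "\<exists>C1 > 0. \<exists>C2 > 0.
    \<forall>(d::nat) (D :: (nat \<Rightarrow> real) set) (q :: nat \<Rightarrow> real) (A :: real set) (t::nat) (I :: nat set)
      (\<epsilon>::real) (\<delta>::real).
      finite D \<longrightarrow> D \<subseteq> unit_vectors d \<longrightarrow> q \<in> unit_vectors d \<longrightarrow>
      A \<subseteq> {0..pi} \<longrightarrow> I \<subseteq> {0..t} \<longrightarrow>
      0 < \<epsilon> \<longrightarrow> \<epsilon> < 1 \<longrightarrow> 0 < \<delta> \<longrightarrow> \<delta> < 1 \<longrightarrow>
      (\<forall>x \<in> angle_set d D q A. near_prob d t I q x > 0) \<longrightarrow>
      (\<exists>m K S :: nat. m > 0 \<and> K > 0 \<and> S > 0 \<and>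
        measure (lsh_count_law d D q A t I m K S)
          {(1 - \<epsilon>) * real (card (angle_set d D q A)) .. (1 + \<epsilon>) * real (card (angle_set d D q A))}
          \<ge> 1 - \<delta> \<and>
        (angle_set d D q A \<noteq> {} \<longrightarrow>
          real (m * K) \<le> C1 *
            (1 / (\<epsilon>\<^sup>2 * (MIN x \<in> angle_set d D q A. near_prob d t I q x)) * max 1 (ln (1 / \<delta>))) \<and>
          real (m * S) \<le> C2 *
            (expected_count d D q t I /
              (\<epsilon>\<^sup>2 * real (card (angle_set d D q A)) *
                (MIN x \<in> angle_set d D q A. near_prob d t I q x)) * max 1 (ln (1 / \<delta>)))))"
\<comment> \<open>81 = 9 * 9 and 153 = 9 * 17: the factors 8, 8 and 16 for copies, tables and
  samples, each raised by 1 through rounding up.\<close>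
proof (rule exI[of _ 81], rule conjI, simp, rule exI[of _ 153], intro conjI allI impI)
  fix d :: nat and D :: "(nat \<Rightarrow> real) set" and q :: "nat \<Rightarrow> real" and A :: "real set"
    and t :: nat and I :: "nat set" and \<epsilon> \<delta> :: real
  assume "finite D" "D \<subseteq> unit_vectors d" "q \<in> unit_vectors d" "A \<subseteq> {0..pi}" "I \<subseteq> {0..t}"
    and \<epsilon>: "0 < \<epsilon>" "\<epsilon> < 1" and \<delta>: "0 < \<delta>" "\<delta> < 1"
    and "\<forall>x \<in> angle_set d D q A. near_prob d t I q x > 0"
  then interpret lsh_instance d D q A t I by unfold_locales auto
  define L where "L = max 1 (ln (1 / \<delta>))"
  define m where "m = nat \<lceil>8 * L\<rceil>"
  have L: "1 \<le> L" by (simp add: L_def)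
  have m: "8 * L \<le> real m" unfolding m_def by (rule ceiling_ge)
  have m_le: "real m \<le> 9 * L" using ceiling_le_mult[of 8 L] L unfolding m_def by simp
  have m0: "m > 0" using m L by (intro gr0I) auto
  note median = median_accuracy[OF _ \<delta>(1) m0 m[unfolded L_def]]
  show "\<exists>m K S :: nat. m > 0 \<and> K > 0 \<and> S > 0 \<and>
        measure (lsh_count_law d D q A t I m K S)
          {(1 - \<epsilon>) * real (card Aq) .. (1 + \<epsilon>) * real (card Aq)} \<ge> 1 - \<delta> \<and>
        (Aq \<noteq> {} \<longrightarrow>
          real (m * K) \<le> 81 * (1 / (\<epsilon>\<^sup>2 * pmin) * max 1 (ln (1 / \<delta>))) \<and>
          real (m * S) \<le> 153 *
            (expected_count d D q t I / (\<epsilon>\<^sup>2 * real (card Aq) * pmin) * max 1 (ln (1 / \<delta>))))"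
  proof (cases "Aq = {}")
    case True
    \<comment> \<open>With no point to count, a single table and a single sample per copy
      suffice.\<close>
    have "1 - \<delta> \<le> measure (lsh_count_law d D q A t I m 1 1) {0..0}"
      by (rule median) (simp only: mean_law_empty[OF True, of 1 1] zero_less_one zero_le_divide_1_iff zero_le_numeral)
    then show ?thesis using True m0 by (intro exI[of _ m] exI[of _ 1]) simp
  next
    case False
    define x where "x = 1 / (\<epsilon>\<^sup>2 * pmin)"
    define y where "y = expected_count d D q t I / (\<epsilon>\<^sup>2 * real (card Aq) * pmin)"
    \<comment> \<open>Rounding up adds less than 1; since x and y are at least 1, this is absorbed
      by raising 8 to 9 and 16 to 17.\<close>
    define K where "K = nat \<lceil>8 * x\<rceil>"
    define S where "S = nat \<lceil>16 * y\<rceil>"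
    have pm: "0 < pmin" "pmin \<le> 1" using pmin_pos pmin_le_1 False by auto
    have n: "real (card Aq) > 0" using False by (simp add: card_gt_0_iff)
    have e2: "0 < \<epsilon>\<^sup>2" "\<epsilon>\<^sup>2 \<le> 1" using \<epsilon> by (auto intro: power_le_one)
    have x1: "1 \<le> x"
      using mult_le_one[OF e2(2) less_imp_le[OF pm(1)] pm(2)] e2 pm by (simp add: x_def)
    have "\<epsilon>\<^sup>2 * (real (card Aq) * pmin) \<le> 1 * expected_count d D q t I"
      using e2 expected_count_ge n pm by (intro mult_mono) auto
    then have y1: "1 \<le> y" using e2 n pm by (simp add: y_def mult.assoc)
    have K: "8 * x \<le> real K" "real K \<le> 9 * x" "K > 0"
      using ceiling_ge[of 8 x] ceiling_le_mult[of 8 x] x1 unfolding K_def by auto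
    have S: "16 * y \<le> real S" "real S \<le> 17 * y" "S > 0"
      using ceiling_ge[of 16 y] ceiling_le_mult[of 16 y] y1 unfolding S_def by auto
    have "1 - \<delta> \<le> measure (lsh_count_law d D q A t I m K S)
          {(1 - \<epsilon>) * real (card Aq) .. (1 + \<epsilon>) * real (card Aq)}"
      by (rule median, rule mean_law_accuracy[OF False \<epsilon> K(3) S(3)])
         (use K(1) S(1) in \<open>simp_all only: x_def y_def\<close>)
    moreover have "real (m * K) \<le> 81 * (x * L)"
      using mult_mono[OF m_le K(2)] L by (simp add: algebra_simps)
    moreover have "real (m * S) \<le> 153 * (y * L)"
      using mult_mono[OF m_le S(2)] L by (simp add: algebra_simps)
    ultimately show ?thesis using m0 K(3) S(3) unfolding x_def y_def L_def by blast
  qed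
qed simp

end
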